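(* Let $n\ge 3$. From the graph $\Gamma_e(\mathcal A_{n+1})$, given without labels of elements on its vertices, one can find all $\gamma_k$, $k=3,\dots,n$, while the first three parameters $\gamma_0,\gamma_1,\gamma_2$ are determined up to isomorphism of $\mathcal A_3=\mathcal A_3\{\gamma_0,\gamma_1,\gamma_2\}$. Precisely: let $\gamma=(\gamma_0,\dots,\gamma_n)$ and $\lambda=(\lambda_0,\dots,\lambda_n)$ be two sequences in $\{1,-1\}^{n+1}$. If $\Gamma_e(\mathcal A^{\gamma}_{n+1})\cong\Gamma_e(\mathcal A^{\lambda}_{n+1})$ as graphs, then $\gamma_k=\lambda_k$ for all $k=3,\dots,n$ and $\mathcal A_3\{\gamma_0,\gamma_1,\gamma_2\}\cong\mathcal A_3\{\lambda_0,\lambda_1,\lambda_2\}$ as algebras.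
   Context: Cayley–Dickson algebras: $\mathcal A_0=\mathbb R$ with trivial conjugation and basis element $e^{(0)}_0=1$. For $\gamma_k\in\{1,-1\}$, $\mathcal A_{k+1}=\mathcal A_k\{\gamma_k\}$ consists of pairs $(a,b)$ of elements of $\mathcal A_k$ with componentwise linear operations, product $(a,b)(c,d)=(ac+\gamma_k\bar d b,\ da+b\bar c)$ and conjugation $\overline{(a,b)}=(\bar a,-b)$; $\mathcal A_m\{\gamma_0,\dots,\gamma_{m-1}\}$ denotes the algebra obtained from $\mathbb R$ with successive parameters $\gamma_0,\dots,\gamma_{m-1}$, and $\mathcal A^{\gamma}_{n+1}=\mathcal A_{n+1}\{\gamma_0,\dots,\gamma_n\}$. The standard basis of $\mathcal A_{k+1}$ is $e^{(k+1)}_j=(e^{(k)}_j,0)$ for $0\le j<2^k$ and $e^{(k+1)}_j=(0,e^{(k)}_{j-2^k})$ for $2^k\le j<2^{k+1}$. $\mathcal E_n$ is the standard basis of $\mathcal A_n$, $e_0$ is the unit, $\mathcal E'_n=\mathcal E_n\setminus\{e_0\}$. Two elements $u,v$ of an algebra are orthogonal if $uv=vu=0$. The graph $\Gamma_e(\mathcal A_{n+1})$: vertices are the lines $\mathbb R(a,b)\subset\mathcal A_{n+1}$ spanned by zero divisors $(a,b)$ with $a\in\mathcal E'_n$, $b\in\pm\mathcal E_n$; two distinct lines are adjacent iff their generators are orthogonal. *)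

theory Defs
  imports Complex_Main "HOL-Library.Function_Algebras"
begin

text \<open>
  The algebra of level \<open>n\<close> has dimension \<open>2 ^ n\<close>, so that no single type carries all levels.
  An element is its coordinate sequence, vanishing from position \<open>2 ^ n\<close> on, and a pair \<open>(a, b)\<close>
  of elements of level \<open>k\<close> is the concatenation of the coordinates of \<open>a\<close> and of \<open>b\<close>.
  Addition, negation and zero are the pointwise ones of functions.
\<close>

type_synonym vec = "nat \<Rightarrow> real"

definition cd_carrier :: "nat \<Rightarrow> vec set" where
  "cd_carrier n = {x. \<forall>i\<ge>2 ^ n. x i = 0}"

definition cd_scale :: "real \<Rightarrow> vec \<Rightarrow> vec" where
  "cd_scale t x = (\<lambda>i. t * x i)"

definition cd_pair :: "nat \<Rightarrow> vec \<Rightarrow> vec \<Rightarrow> vec" where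
  "cd_pair k a b = (\<lambda>i. if i < 2 ^ k then a i else b (i - 2 ^ k))"

definition cd_fst :: "nat \<Rightarrow> vec \<Rightarrow> vec" where
  "cd_fst k x = (\<lambda>i. if i < 2 ^ k then x i else 0)"

definition cd_snd :: "nat \<Rightarrow> vec \<Rightarrow> vec" where
  "cd_snd k x = (\<lambda>i. if i < 2 ^ k then x (i + 2 ^ k) else 0)"

primrec cd_conj :: "nat \<Rightarrow> vec \<Rightarrow> vec" where
  "cd_conj 0 x = x"
| "cd_conj (Suc k) x = cd_pair k (cd_conj k (cd_fst k x)) (- cd_snd k x)"

text \<open>
  \<open>cd_mult \<gamma> n\<close> is the product of the algebra with parameters \<open>\<gamma> 0, \<dots>, \<gamma> (n - 1)\<close>; the other
  values of \<open>\<gamma>\<close> are irrelevant.  Lemma \<open>cd_mult_pair\<close> below gives the doubling formula on pairs.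
\<close>

primrec cd_mult :: "(nat \<Rightarrow> real) \<Rightarrow> nat \<Rightarrow> vec \<Rightarrow> vec \<Rightarrow> vec" where
  "cd_mult \<gamma> 0 x y = (\<lambda>i. if i = 0 then x 0 * y 0 else 0)"
| "cd_mult \<gamma> (Suc k) x y =
    (let a = cd_fst k x; b = cd_snd k x; c = cd_fst k y; d = cd_snd k y in
      cd_pair k
        (cd_mult \<gamma> k a c + cd_scale (\<gamma> k) (cd_mult \<gamma> k (cd_conj k d) b))
        (cd_mult \<gamma> k d a + cd_mult \<gamma> k b (cd_conj k c)))"

primrec cd_basis :: "nat \<Rightarrow> nat \<Rightarrow> vec" where
  "cd_basis 0 j = (\<lambda>i. if i = 0 then 1 else 0)"
| "cd_basis (Suc k) j =
    (if j < 2 ^ k then cd_pair k (cd_basis k j) 0 else cd_pair k 0 (cd_basis k (j - 2 ^ k)))"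

definition std_basis :: "nat \<Rightarrow> vec set" where
  "std_basis n = cd_basis n ` {..<2 ^ n}"

definition std_basis' :: "nat \<Rightarrow> vec set" where
  "std_basis' n = std_basis n - {cd_basis n 0}"

definition cd_orthogonal :: "(nat \<Rightarrow> real) \<Rightarrow> nat \<Rightarrow> vec \<Rightarrow> vec \<Rightarrow> bool" where
  "cd_orthogonal \<gamma> n u v \<longleftrightarrow> cd_mult \<gamma> n u v = 0 \<and> cd_mult \<gamma> n v u = 0"

definition cd_zero_divisor :: "(nat \<Rightarrow> real) \<Rightarrow> nat \<Rightarrow> vec \<Rightarrow> bool" where
  "cd_zero_divisor \<gamma> n u \<longleftrightarrow> u \<in> cd_carrier n \<and> u \<noteq> 0 \<and>
    (\<exists>v\<in>cd_carrier n. v \<noteq> 0 \<and> (cd_mult \<gamma> n u v = 0 \<or> cd_mult \<gamma> n v u = 0))"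

definition line :: "vec \<Rightarrow> vec set" where
  "line u = {cd_scale t u | t. True}"

text \<open>
  Below, \<open>n\<close> is the level of the components \<open>a\<close> and \<open>b\<close>; the graph is that of the algebra of
  level \<open>n + 1\<close>.
\<close>

definition Gamma_gens :: "(nat \<Rightarrow> real) \<Rightarrow> nat \<Rightarrow> vec set" where
  "Gamma_gens \<gamma> n = {cd_pair n a b | a b.
     a \<in> std_basis' n \<and> b \<in> std_basis n \<union> uminus ` std_basis n \<and>
     cd_zero_divisor \<gamma> (Suc n) (cd_pair n a b)}"

definition Gamma_verts :: "(nat \<Rightarrow> real) \<Rightarrow> nat \<Rightarrow> vec set set" where
  "Gamma_verts \<gamma> n = line ` Gamma_gens \<gamma> n"

definition Gamma_adj :: "(nat \<Rightarrow> real) \<Rightarrow> nat \<Rightarrow> vec set \<Rightarrow> vec set \<Rightarrow> bool" where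
  "Gamma_adj \<gamma> n L M \<longleftrightarrow> L \<noteq> M \<and>
    (\<exists>u\<in>Gamma_gens \<gamma> n. \<exists>v\<in>Gamma_gens \<gamma> n.
      L = line u \<and> M = line v \<and> cd_orthogonal \<gamma> (Suc n) u v)"

definition graph_isomorphic ::
    "'a set \<Rightarrow> ('a \<Rightarrow> 'a \<Rightarrow> bool) \<Rightarrow> 'b set \<Rightarrow> ('b \<Rightarrow> 'b \<Rightarrow> bool) \<Rightarrow> bool" where
  "graph_isomorphic V E W F \<longleftrightarrow>
    (\<exists>f. bij_betw f V W \<and> (\<forall>x\<in>V. \<forall>y\<in>V. E x y \<longleftrightarrow> F (f x) (f y)))"

definition cd_algebra_isomorphic :: "nat \<Rightarrow> (nat \<Rightarrow> real) \<Rightarrow> (nat \<Rightarrow> real) \<Rightarrow> bool" where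
  "cd_algebra_isomorphic n \<gamma> \<delta> \<longleftrightarrow>
    (\<exists>f. bij_betw f (cd_carrier n) (cd_carrier n) \<and>
      (\<forall>x\<in>cd_carrier n. \<forall>y\<in>cd_carrier n. f (x + y) = f x + f y) \<and>
      (\<forall>t. \<forall>x\<in>cd_carrier n. f (cd_scale t x) = cd_scale t (f x)) \<and>
      (\<forall>x\<in>cd_carrier n. \<forall>y\<in>cd_carrier n. f (cd_mult \<gamma> n x y) = cd_mult \<delta> n (f x) (f y)))"

lemma cd_fst_pair: "a \<in> cd_carrier k \<Longrightarrow> cd_fst k (cd_pair k a b) = a"
  by (auto simp: cd_carrier_def cd_fst_def cd_pair_def fun_eq_iff)

lemma cd_snd_pair: "b \<in> cd_carrier k \<Longrightarrow> cd_snd k (cd_pair k a b) = b"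
  by (auto simp: cd_carrier_def cd_snd_def cd_pair_def fun_eq_iff)

lemma cd_carrier_Suc:
  "cd_carrier (Suc k) = {cd_pair k a b | a b. a \<in> cd_carrier k \<and> b \<in> cd_carrier k}"
proof (intro set_eqI iffI)
  fix x assume x: "x \<in> cd_carrier (Suc k)"
  have "x = cd_pair k (cd_fst k x) (cd_snd k x)"
    using x by (auto simp: cd_carrier_def cd_fst_def cd_snd_def cd_pair_def fun_eq_iff)
  moreover have "cd_fst k x \<in> cd_carrier k" "cd_snd k x \<in> cd_carrier k"
    by (auto simp: cd_carrier_def cd_fst_def cd_snd_def)
  ultimately show "x \<in> {cd_pair k a b | a b. a \<in> cd_carrier k \<and> b \<in> cd_carrier k}"
    by blast
next
  fix x assume "x \<in> {cd_pair k a b | a b. a \<in> cd_carrier k \<and> b \<in> cd_carrier k}"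
  then show "x \<in> cd_carrier (Suc k)"
    by (auto simp: cd_carrier_def cd_pair_def)
qed

lemma cd_conj_pair:
  assumes "a \<in> cd_carrier k" "b \<in> cd_carrier k"
  shows "cd_conj (Suc k) (cd_pair k a b) = cd_pair k (cd_conj k a) (- b)"
  using assms by (simp add: cd_fst_pair cd_snd_pair)

lemma cd_mult_pair:
  assumes "a \<in> cd_carrier k" "b \<in> cd_carrier k" "c \<in> cd_carrier k" "d \<in> cd_carrier k"
  shows "cd_mult \<gamma> (Suc k) (cd_pair k a b) (cd_pair k c d) =
    cd_pair k
      (cd_mult \<gamma> k a c + cd_scale (\<gamma> k) (cd_mult \<gamma> k (cd_conj k d) b))
      (cd_mult \<gamma> k d a + cd_mult \<gamma> k b (cd_conj k c))"
  using assms by (simp add: cd_fst_pair cd_snd_pair)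

lemma cd_basis_eq: "j < 2 ^ n \<Longrightarrow> cd_basis n j = (\<lambda>i. if i = j then 1 else 0)"
proof (induction n arbitrary: j)
  case 0
  then show ?case by simp
next
  case (Suc n)
  show ?case
  proof (cases "j < 2 ^ n")
    case True
    then show ?thesis using Suc.IH[of j] by (auto simp: cd_pair_def fun_eq_iff)
  next
    case False
    then have "j - 2 ^ n < 2 ^ n" using Suc.prems by simp
    then show ?thesis using False Suc.IH[of "j - 2 ^ n"] by (auto simp: cd_pair_def fun_eq_iff)
  qed
qed

end

(* Products of basis elements are signed basis elements, e_i e_j = \<plusminus>e_k with k the bitwise exclusive or of
   i and j, so a vertex is a triple (h, i, s) standing for the line of (e_i, s e_j), j = i xor h, and
   orthogonality preserves h.  For fixed h the edges join each (i, s) to at most one sign over each k;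
   whether k occurs is decided by comparing \<gamma>_n with a product of four structure signs, which for
   h, i, k independent over F_2 is \<plusminus>(norm of e_h), the sign depending only on the indices and not on
   the parameters.

   If the norm of e_h is \<gamma>_n, the vertex (h, h, s) is adjacent to a vertex over every k other than 0
   and h.  These centres, together with the vertices (0, i, s) when \<gamma>_n = 1, are exactly the vertices of
   the maximal degree 2^n - 2, and the number of neighbours of degree 2 of such a vertex is 0 when h = 0,
   2^n - 2 when h < 8 or h is a power of 2, and 2^(n-m+1) - 2 when 2^m < h < 2^(m+1), m \<ge> 3.
   Hence the graph determines \<gamma>_n and, for each m, how many h between 2^m and 2^(m+1) have norm \<gamma>_n.
   As the norm is multiplicative with value -\<gamma>_m at 2^m, these counts give \<gamma>_m for m \<ge> 3 and
   tell whether \<gamma>_0 = \<gamma>_1 = \<gamma>_2 = -1; all other octonion algebras are isomorphic to each other. *)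

theory Submission
  imports Defs
begin

unbundle bit_operations_syntax

subsection \<open>Structure signs of the standard basis\<close>

lemma xor_self_left [simp]: "a XOR (a XOR b) = (b::nat)"
  by (simp flip: xor.assoc)

lemma xor_eq_0_iff [simp]: "a XOR b = 0 \<longleftrightarrow> a = (b::nat)"
  by (metis xor_self_left xor_self_eq xor.right_neutral)

lemma xor_self_right [simp]: "(a XOR b) XOR b = (a::nat)"
  by (simp add: xor.assoc)

lemma xor_gr_0_iff [simp]: "0 < a XOR b \<longleftrightarrow> a \<noteq> (b::nat)"
  by (metis gr0I less_irrefl xor_eq_0_iff)

lemma xor_left_cancel [simp]: "a XOR b = a XOR c \<longleftrightarrow> b = (c::nat)"
  by (metis xor_self_left)

lemma xor_right_cancel [simp]: "b XOR a = c XOR a \<longleftrightarrow> b = (c::nat)"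
  by (metis xor.commute xor_left_cancel)

lemma xor_eq_left_iff [simp]: "a XOR b = a \<longleftrightarrow> b = (0::nat)"
  by (metis xor.right_neutral xor_left_cancel)

lemma xor_eq_right_iff [simp]: "a XOR b = b \<longleftrightarrow> a = (0::nat)"
  by (metis xor.commute xor_eq_left_iff)

lemma eq_xor_left_iff [simp]: "a = a XOR b \<longleftrightarrow> b = (0::nat)"
  by (metis xor_eq_left_iff)

lemma eq_xor_right_iff [simp]: "b = a XOR b \<longleftrightarrow> a = (0::nat)"
  by (metis xor_eq_right_iff)

lemma xor_less_exp [simp]:
  assumes "a < 2 ^ n" "b < 2 ^ n"
  shows "a XOR b < (2::nat) ^ n"
  using assms by (metis take_bit_nat_eq_self_iff take_bit_xor)

lemma add_exp_eq_xor: "a < 2 ^ n \<Longrightarrow> a + 2 ^ n = a XOR (2::nat) ^ n"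
  by (rule disjunctive_add_eq_xor)
    (metis and_exp_eq_0_iff_not_bit bit_take_bit_iff less_irrefl take_bit_nat_eq_self_iff)

lemma xor_add_exp [simp]:
  assumes "a < 2 ^ n" "b < 2 ^ n"
  shows "(a + 2 ^ n) XOR b = (a XOR b) + (2::nat) ^ n"
    and "a XOR (b + 2 ^ n) = (a XOR b) + (2::nat) ^ n"
    and "(a + 2 ^ n) XOR (b + 2 ^ n) = a XOR b"
  using assms by (simp_all add: add_exp_eq_xor xor.assoc xor.left_commute xor.commute)

lemma xor_exp [simp]: "a < 2 ^ n \<Longrightarrow> a XOR (2::nat) ^ n = a + 2 ^ n" "a < 2 ^ n \<Longrightarrow> (2::nat) ^ n XOR a = a + 2 ^ n"
  by (simp_all add: add_exp_eq_xor xor.commute)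

lemma less_exp_Suc_cases:
  assumes "(i::nat) < 2 ^ Suc n"
  obtains "i < 2 ^ n" | j where "j < 2 ^ n" "i = j + 2 ^ n"
proof (cases "i < 2 ^ n")
  case False
  then show ?thesis using assms that(2)[of "i - 2 ^ n"] by simp
qed (rule that(1))

lemma less_exp_Suc_low:
  assumes "(i::nat) < 2 ^ Suc n"
  obtains j where "j < 2 ^ n" "i = j \<or> i = j + 2 ^ n"
  using less_exp_Suc_cases[OF assms] that by metis

text \<open>The standard basis satisfies \<open>e\<^sub>i e\<^sub>j = bsign \<gamma> n i j e\<^sub>k\<close>, where \<open>k = i XOR j\<close>,
  and \<open>bnorm \<gamma> n i\<close> is the value at \<open>e\<^sub>i\<close> of the norm form \<open>x \<cdot> cd_conj x\<close>.\<close>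

definition csign :: "nat \<Rightarrow> real" where
  "csign j = (if j = 0 then 1 else -1)"

primrec bsign :: "(nat \<Rightarrow> real) \<Rightarrow> nat \<Rightarrow> nat \<Rightarrow> nat \<Rightarrow> real" where
  "bsign \<gamma> 0 i j = 1"
| "bsign \<gamma> (Suc n) i j =
    (if i < 2 ^ n then
       if j < 2 ^ n then bsign \<gamma> n i j else bsign \<gamma> n (j - 2 ^ n) i
     else
       if j < 2 ^ n then csign j * bsign \<gamma> n (i - 2 ^ n) j
       else \<gamma> n * csign (j - 2 ^ n) * bsign \<gamma> n (j - 2 ^ n) (i - 2 ^ n))"

primrec bnorm :: "(nat \<Rightarrow> real) \<Rightarrow> nat \<Rightarrow> nat \<Rightarrow> real" where
  "bnorm \<gamma> 0 i = 1"
| "bnorm \<gamma> (Suc n) i = (if i < 2 ^ n then bnorm \<gamma> n i else - \<gamma> n * bnorm \<gamma> n (i - 2 ^ n))"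

text \<open>Independence over the field with two elements.\<close>

definition indep :: "nat \<Rightarrow> nat \<Rightarrow> nat \<Rightarrow> bool" where
  "indep h i k \<longleftrightarrow> h \<noteq> 0 \<and> i \<noteq> 0 \<and> i \<noteq> h \<and> k \<noteq> 0 \<and> k \<noteq> h \<and> k \<noteq> i \<and> k \<noteq> i XOR h"

text \<open>Orthogonality forces the last two factors as the ratio of the signs of two vertices over
  \<open>i\<close> and \<open>k\<close>; after this substitution, and with
  \<open>csign (k XOR h) = -1\<close>, the remaining condition reads
  \<open>qsign \<gamma> n h i k = \<gamma> n\<close>.\<close>

definition qsign :: "(nat \<Rightarrow> real) \<Rightarrow> nat \<Rightarrow> nat \<Rightarrow> nat \<Rightarrow> nat \<Rightarrow> real" where
  "qsign \<gamma> n h i k = bsign \<gamma> n i k * bsign \<gamma> n (k XOR h) (i XOR h)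
     * bsign \<gamma> n (k XOR h) i * bsign \<gamma> n (i XOR h) k"

lemma indep_xor: "indep h (i XOR h) k = indep h i k" "indep h i (k XOR h) = indep h i k"
  unfolding indep_def by (auto simp: xor.assoc xor.commute)

lemma indep_sym: "indep h i k \<Longrightarrow> indep h k i"
  unfolding indep_def by (metis xor.commute xor_self_left)

lemma csign_sq [simp]: "csign 0 = 1" "csign j * csign j = 1" "csign j * (csign j * x) = x"
  by (auto simp: csign_def)

section \<open>Basic identities for structure signs and norms\<close>

locale sign_params =
  fixes \<gamma> :: "nat \<Rightarrow> real"
  assumes sign: "\<gamma> k = 1 \<or> \<gamma> k = -1"
begin

abbreviation "\<sigma> \<equiv> bsign \<gamma>"
abbreviation "\<nu> \<equiv> bnorm \<gamma>"
abbreviation "F \<equiv> qsign \<gamma>"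

lemma \<gamma>_sq [simp]: "\<gamma> k * \<gamma> k = 1" "\<gamma> k * (\<gamma> k * x) = x"
  using sign[of k] by auto

lemma \<sigma>_cases: "\<sigma> n i j = 1 \<or> \<sigma> n i j = -1"
proof (induction n arbitrary: i j)
  case (Suc n)
  show ?case
    using Suc[of i j] Suc[of "j - 2 ^ n" i] Suc[of "i - 2 ^ n" j] Suc[of "j - 2 ^ n" "i - 2 ^ n"]
      sign[of n] by (auto simp: csign_def)
qed simp

lemma \<sigma>_sq [simp]: "\<sigma> n i j * \<sigma> n i j = 1" "\<sigma> n i j * (\<sigma> n i j * x) = x"
  using \<sigma>_cases[of n i j] by auto

lemma \<nu>_cases: "\<nu> n i = 1 \<or> \<nu> n i = -1"
proof (induction n arbitrary: i)
  case (Suc n)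
  show ?case using Suc[of i] Suc[of "i - 2 ^ n"] sign[of n] by auto
qed simp

lemma \<nu>_sq [simp]: "\<nu> n i * \<nu> n i = 1" "\<nu> n i * (\<nu> n i * x) = x"
  using \<nu>_cases[of n i] by auto

lemma \<nu>_0 [simp]: "\<nu> n 0 = 1"
  by (induction n) auto

text \<open>\<open>\<nu> n i\<close> is the product of \<open>- \<gamma> k\<close> over the binary
  digits 1 of \<open>i\<close>, hence a character of the XOR group.\<close>

lemma \<nu>_xor: "i < 2 ^ n \<Longrightarrow> j < 2 ^ n \<Longrightarrow> \<nu> n (i XOR j) = \<nu> n i * \<nu> n j"
proof (induction n arbitrary: i j)
  case (Suc n)
  from Suc.prems show ?case
    by (elim less_exp_Suc_cases) (auto simp: Suc.IH mult_ac)
qed simp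

lemma \<sigma>_0 [simp]:
  shows "i < 2 ^ n \<Longrightarrow> \<sigma> n i 0 = 1" and "i < 2 ^ n \<Longrightarrow> \<sigma> n 0 i = 1"
proof -
  have "i < 2 ^ n \<longrightarrow> \<sigma> n i 0 = 1 \<and> \<sigma> n 0 i = 1"
    by (induction n arbitrary: i) (auto simp: csign_def)
  then show "i < 2 ^ n \<Longrightarrow> \<sigma> n i 0 = 1" "i < 2 ^ n \<Longrightarrow> \<sigma> n 0 i = 1" by auto
qed

lemma \<sigma>_anticomm:
  assumes "i < 2 ^ n" "j < 2 ^ n" "i \<noteq> 0" "j \<noteq> 0" "i \<noteq> j"
  shows "\<sigma> n i j = - \<sigma> n j i"
  using assms
proof (induction n arbitrary: i j)
  case (Suc n)
  have *: "\<sigma> n a b = - \<sigma> n b a \<or> a = 0 \<or> b = 0 \<or> a = b" if "a < 2 ^ n" "b < 2 ^ n" for a b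
    using Suc.IH that by blast
  from Suc.prems(1,2) show ?case
    using Suc.prems(3-) by (elim less_exp_Suc_cases) (use * in \<open>auto simp: csign_def\<close>)
qed simp

lemma \<sigma>_self: "i < 2 ^ n \<Longrightarrow> i \<noteq> 0 \<Longrightarrow> \<sigma> n i i = - \<nu> n i"
proof (induction n arbitrary: i)
  case (Suc n)
  from Suc.prems(1) show ?case
    using Suc.prems(2) Suc.IH by (elim less_exp_Suc_cases) (auto simp: csign_def)
qed simp

text \<open>Both factors anticommute. The left identity stays a hypothesis because the induction for
  \<open>\<sigma>_left_alt\<close> needs both forms at the lower level, doubling having reversed
  some products.\<close>

lemma \<sigma>_right_of_left:
  assumes "\<And>k. k < 2 ^ n \<Longrightarrow> \<sigma> n h k * \<sigma> n h (k XOR h) = - \<nu> n h"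
    and "h < 2 ^ n" "k < 2 ^ n" "h \<noteq> 0"
  shows "\<sigma> n k h * \<sigma> n (k XOR h) h = - \<nu> n h"
proof (cases "k = 0 \<or> k = h")
  case False
  then have "\<sigma> n k h = - \<sigma> n h k" "\<sigma> n (k XOR h) h = - \<sigma> n h (k XOR h)"
    using assms by (auto intro!: \<sigma>_anticomm)
  then show ?thesis using assms(1)[of k] assms by simp
qed (use assms \<sigma>_self in auto)

text \<open>In coordinates, \<open>e_h (e_h e_k) = (e_h e_h) e_k\<close>: basis units obey the
  alternative law at every level, even though the algebras beyond the octonions are not
  alternative.\<close>

lemma \<sigma>_left_alt:
  assumes "h < 2 ^ n" "k < 2 ^ n" "h \<noteq> 0"
  shows "\<sigma> n h k * \<sigma> n h (k XOR h) = - \<nu> n h"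
  using assms
proof (induction n arbitrary: h k)
  case (Suc n)
  have R: "\<sigma> n k h * \<sigma> n (k XOR h) h = - \<nu> n h" if "h < 2 ^ n" "k < 2 ^ n" "h \<noteq> 0" for h k
    using \<sigma>_right_of_left Suc.IH that by blast
  from Suc.prems(1,2) show ?case
  proof (elim less_exp_Suc_cases)
    fix h' assume h: "h' < 2 ^ n" "h = h' + 2 ^ n" and k: "k < 2 ^ n"
    \<comment> \<open>Conjugation enters through two \<open>csign\<close> factors; they can differ
      only if \<open>k\<close> or \<open>k XOR h'\<close> is 0, so these cases are treated
      apart.\<close>
    have "csign k * (\<sigma> n h' k * (csign (k XOR h') * \<sigma> n (k XOR h') h')) = \<nu> n h'"
    proof (cases "h' = 0 \<or> k = 0 \<or> k = h'")
      case True
      then show ?thesis using h k \<sigma>_self[of h' n] by (auto simp: csign_def)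
    next
      case False
      then have "\<sigma> n h' k = - \<sigma> n k h'" using h k by (intro \<sigma>_anticomm) auto
      then show ?thesis using False h k R[of h' k] by (auto simp: csign_def)
    qed
    then show ?thesis using h k by (simp add: mult_ac)
  next
    fix h' k' assume h: "h' < 2 ^ n" "h = h' + 2 ^ n" and k: "k' < 2 ^ n" "k = k' + 2 ^ n"
    have "csign k' * (csign (k' XOR h') * (\<sigma> n k' h' * \<sigma> n h' (k' XOR h'))) = \<nu> n h'"
    proof (cases "h' = 0 \<or> k' = 0 \<or> k' = h'")
      case True
      then show ?thesis using h k \<sigma>_self[of h' n] by (auto simp: csign_def)
    next
      case False
      then have "\<sigma> n k' h' = - \<sigma> n h' k'" using h k by (intro \<sigma>_anticomm) auto
      then show ?thesis using False h k Suc.IH[of h' k'] by (auto simp: csign_def)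
    qed
    then show ?thesis using h k by (simp add: mult_ac)
  qed (use Suc.IH Suc.prems R in auto)
qed simp

lemma \<sigma>_right_alt:
  "h < 2 ^ n \<Longrightarrow> k < 2 ^ n \<Longrightarrow> h \<noteq> 0 \<Longrightarrow> \<sigma> n k h * \<sigma> n (k XOR h) h = - \<nu> n h"
  using \<sigma>_right_of_left \<sigma>_left_alt by blast

lemma indep_anticomm:
  assumes "indep h i k" "h < 2 ^ n" "i < 2 ^ n" "k < 2 ^ n"
  shows "\<sigma> n k i = - \<sigma> n i k" "\<sigma> n (k XOR h) i = - \<sigma> n i (k XOR h)"
    "\<sigma> n k (i XOR h) = - \<sigma> n (i XOR h) k"
    "\<sigma> n (k XOR h) (i XOR h) = - \<sigma> n (i XOR h) (k XOR h)"
    "csign i = -1" "csign k = -1" "csign (i XOR h) = -1" "csign (k XOR h) = -1"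
proof -
  have "k \<noteq> i" "k \<noteq> i XOR h" "k XOR h \<noteq> i" "i \<noteq> 0" "k \<noteq> 0" "i \<noteq> h" "k \<noteq> h"
    using assms(1) unfolding indep_def by auto
  then show "\<sigma> n k i = - \<sigma> n i k" "\<sigma> n (k XOR h) i = - \<sigma> n i (k XOR h)"
    "\<sigma> n k (i XOR h) = - \<sigma> n (i XOR h) k"
    "\<sigma> n (k XOR h) (i XOR h) = - \<sigma> n (i XOR h) (k XOR h)"
    "csign i = -1" "csign k = -1" "csign (i XOR h) = -1" "csign (k XOR h) = -1"
    using assms by (auto intro!: \<sigma>_anticomm simp: csign_def)
qed

section \<open>The product of four signs under doubling\<close>

lemma qsign_xor: "F n h (i XOR h) k = F n h i k"
  by (simp add: qsign_def mult_ac)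

text \<open>Exchanging \<open>i\<close> and \<open>k\<close> reverses the first two products and
  permutes the last two; the two changes of sign cancel.\<close>

lemma qsign_sym:
  assumes "indep h i k" "h < 2 ^ n" "i < 2 ^ n" "k < 2 ^ n"
  shows "F n h k i = F n h i k"
  using indep_anticomm[OF assms] by (simp add: qsign_def mult_ac)

text \<open>The reversed products and the \<open>csign\<close> factors contribute signs -1 that
  cancel. When only \<open>h\<close> lies in the upper half, exactly one of the four products is
  between two upper indices and carries \<open>\<gamma> n\<close>; otherwise none or all four
  do.\<close>

lemma qsign_Suc:
  assumes "indep h i k" and less: "h < 2 ^ n" "i < 2 ^ n" "k < 2 ^ n"
  shows "F (Suc n) h i k = F n h i k" "F (Suc n) h (i + 2 ^ n) k = F n h i k"
    "F (Suc n) h i (k + 2 ^ n) = F n h i k" "F (Suc n) h (i + 2 ^ n) (k + 2 ^ n) = F n h i k"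
    "F (Suc n) (h + 2 ^ n) i k = \<gamma> n * F n h i k"
  using less indep_anticomm[OF assms] by (simp_all add: qsign_def mult_ac)

text \<open>Representatives of the dependent lower parts: \<open>i\<close> over 0 with
  \<open>k\<close> in either half, and \<open>i\<close> over \<open>k\<close>. Alternativity and the
  squares of basis units reduce the product to the norm.\<close>

lemma qsign_Suc_degenerate_aux:
  assumes less: "h < 2 ^ n" "k < 2 ^ n" and ne: "h \<noteq> 0" "k \<noteq> 0" "k \<noteq> h"
  shows "F (Suc n) h (2 ^ n) k = - \<nu> n h" "F (Suc n) h (2 ^ n) (k + 2 ^ n) = - \<nu> n h"
    "F (Suc n) h (k + 2 ^ n) k = - \<nu> n h"
proof -
  have L: "\<sigma> n h (k XOR h) = - \<nu> n h * \<sigma> n h k" and R: "\<sigma> n (k XOR h) h = - \<nu> n h * \<sigma> n k h"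
    using \<sigma>_left_alt[of h n k] \<sigma>_right_alt[of h n k] assms
    by (metis \<sigma>_sq mult.commute)+
  have C: "\<sigma> n h k = - \<sigma> n k h" using assms by (intro \<sigma>_anticomm) auto
  have S: "\<sigma> n k k = - \<nu> n k" "\<sigma> n (k XOR h) (k XOR h) = - \<nu> n k * \<nu> n h"
    using assms by (auto simp: \<sigma>_self \<nu>_xor)
  have E: "csign k = -1" "csign (k XOR h) = -1" "csign h = -1" using ne by (auto simp: csign_def)
  have C': "\<sigma> n k (k XOR h) = - \<sigma> n (k XOR h) k" using assms by (intro \<sigma>_anticomm) auto
  show "F (Suc n) h (2 ^ n) k = - \<nu> n h" "F (Suc n) h (2 ^ n) (k + 2 ^ n) = - \<nu> n h"
    "F (Suc n) h (k + 2 ^ n) k = - \<nu> n h"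
    using assms by (simp_all add: qsign_def L R C C' S E mult_ac)
qed

text \<open>Here independence is due to the top bit alone. The moves from \<open>i\<close> to
  \<open>i XOR h\<close> and the exchange of \<open>i\<close> and \<open>k\<close> lead to the
  configurations already computed.\<close>

lemma qsign_Suc_degenerate:
  assumes less: "h < 2 ^ n" "i < 2 ^ n" "k < 2 ^ n" and "\<not> indep h i k"
    and I: "I = i \<or> I = i + 2 ^ n" and K: "K = k \<or> K = k + 2 ^ n" and ind: "indep h I K"
  shows "F (Suc n) h I K = - \<nu> n h"
proof -
  have h0: "h \<noteq> 0" using ind by (simp add: indep_def)
  have Ih: "I XOR h = i XOR h \<and> I = i \<or> I XOR h = (i XOR h) + 2 ^ n \<and> I = i + 2 ^ n"
    using I less by auto
  have A: "F (Suc n) h J L = - \<nu> n h"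
    if "j < 2 ^ n" "l < 2 ^ n" "J = j \<or> J = j + 2 ^ n" "L = l \<or> L = l + 2 ^ n" "indep h J L"
      "j = 0 \<or> j = h" for j l J L
  proof -
    \<comment> \<open>As \<open>j\<close> is 0 or \<open>h\<close>, independence forces the top bit
      on \<open>J\<close>.\<close>
    have l: "l \<noteq> 0 \<and> l \<noteq> h" and J: "J = j + 2 ^ n"
      using that less h0 by (auto simp: indep_def)
    have "F (Suc n) h (2 ^ n) L = - \<nu> n h"
      using qsign_Suc_degenerate_aux[of h n l] l less h0 that by auto
    moreover have "J = 2 ^ n \<or> J = (2 ^ n) XOR h"
      using J that less xor_exp[of h n] by auto
    ultimately show ?thesis by (auto simp: qsign_xor)
  qed
  have less': "h < 2 ^ Suc n" "I < 2 ^ Suc n" "K < 2 ^ Suc n" using I K less by auto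
  consider "i = 0 \<or> i = h" | "k = 0 \<or> k = h" | "i \<noteq> 0" "i \<noteq> h" "k \<noteq> 0" "k \<noteq> h" "k = i \<or> k = i XOR h"
    using \<open>\<not> indep h i k\<close> h0 by (auto simp: indep_def)
  then show ?thesis
  proof cases
    case 1
    then show ?thesis using A[of i k I K] assms by auto
  next
    case 2
    then have "F (Suc n) h K I = - \<nu> n h" using A[of k i K I] assms indep_sym by blast
    then show ?thesis using qsign_sym[OF ind less'] by simp
  next
    case 3
    have B: "F (Suc n) h (j + 2 ^ n) l = - \<nu> n h"
      if "l < 2 ^ n" "l \<noteq> 0" "l \<noteq> h" "j = l \<or> j = l XOR h" for j l
    proof -
      have "F (Suc n) h (l + 2 ^ n) l = - \<nu> n h"
        using qsign_Suc_degenerate_aux(3)[of h n l] that less h0 by auto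
      moreover have "(l XOR h) + 2 ^ n = (l + 2 ^ n) XOR h" using less that by simp
      ultimately show ?thesis using that qsign_xor[of "Suc n" h "l + 2 ^ n" l] by auto
    qed
    \<comment> \<open>Equal top bits would make \<open>K\<close> equal to \<open>I\<close> or
      \<open>I XOR h\<close>.\<close>
    have "I = i + 2 ^ n \<and> K = k \<or> I = i \<and> K = k + 2 ^ n"
      using I K ind 3(5) less by (auto simp: indep_def)
    then show ?thesis
    proof
      assume "I = i + 2 ^ n \<and> K = k"
      then show ?thesis using B[of k i] 3 less by auto
    next
      assume "I = i \<and> K = k + 2 ^ n"
      then show ?thesis using B[of i k] 3 less qsign_sym[OF ind less'] by auto
    qed
  qed
qed

text \<open>The index \<open>h + 2 ^ n\<close> has norm \<open>- \<gamma> n * bnorm \<gamma> n h\<close>: as in the previous lemma,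
  \<open>qsign\<close> is minus the norm as soon as the lower parts are dependent.\<close>

lemma qsign_Suc_degenerate_top:
  assumes less: "h < 2 ^ n" "i < 2 ^ n" "k < 2 ^ n" and "\<not> indep h i k"
    and ne: "i \<noteq> 0" "k \<noteq> 0" "k \<noteq> i"
  shows "F (Suc n) (h + 2 ^ n) i k = \<gamma> n * \<nu> n h"
proof -
  have ind: "indep (h + 2 ^ n) a b" if "a < 2 ^ n" "b < 2 ^ n" "a \<noteq> 0" "b \<noteq> 0" "a \<noteq> b" for a b
    using that less by (auto simp: indep_def)
  have A: "F (Suc n) (h + 2 ^ n) h k = \<gamma> n * \<nu> n h" if "h \<noteq> 0" "k \<noteq> 0" "k \<noteq> h" "k < 2 ^ n" for k
  proof -
    have R: "\<sigma> n (k XOR h) h = - \<nu> n h * \<sigma> n k h"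
      using \<sigma>_right_alt[of h n k] that less by (metis \<sigma>_sq mult.commute)
    have C: "\<sigma> n h k = - \<sigma> n k h" using less that by (intro \<sigma>_anticomm) auto
    show ?thesis using that less by (simp add: qsign_def R C mult_ac csign_def)
  qed
  consider "h = 0" | "h \<noteq> 0" "i = h" | "h \<noteq> 0" "k = h" | "h \<noteq> 0" "i \<noteq> h" "k \<noteq> h" "k = i XOR h"
    using assms by (auto simp: indep_def)
  then show ?thesis
  proof cases
    case 1
    have "\<sigma> n k i = - \<sigma> n i k" using assms by (intro \<sigma>_anticomm) auto
    then show ?thesis using assms 1 by (simp add: qsign_def mult_ac csign_def)
  next
    case 2
    then show ?thesis using A assms by auto
  next
    case 3
    then show ?thesis using A[of i] qsign_sym[OF ind[of k i], of "Suc n"] assms by auto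
  next
    case 4
    have "\<sigma> n i (i XOR h) = - \<sigma> n (i XOR h) i" using assms 4 by (intro \<sigma>_anticomm) auto
    moreover have "\<sigma> n i i = - \<nu> n i" "\<sigma> n (i XOR h) (i XOR h) = - \<nu> n i * \<nu> n h"
      using assms 4 by (auto simp: \<sigma>_self \<nu>_xor)
    ultimately show ?thesis using assms 4 by (simp add: qsign_def mult_ac csign_def)
  qed
qed

section \<open>Rows on which the four-sign product is constantly minus the norm\<close>

definition full_row :: "nat \<Rightarrow> nat \<Rightarrow> nat \<Rightarrow> bool" where
  "full_row n h i \<longleftrightarrow> (\<forall>k<2 ^ n. indep h i k \<longrightarrow> F n h i k = - \<nu> n h)"

text \<open>For \<open>\<nu> n h = \<gamma> n\<close> these rows are the vertices without a
  neighbour independent of \<open>h\<close> and \<open>i\<close>, that is, the vertices of degree 2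
  next to the centre \<open>(h, h, s)\<close>.\<close>

definition full_rows :: "nat \<Rightarrow> nat \<Rightarrow> nat set" where
  "full_rows n h = {i. i < 2 ^ n \<and> i \<noteq> 0 \<and> i \<noteq> h \<and> full_row n h i}"

lemma full_row_xor: "full_row n h (i XOR h) = full_row n h i"
  by (simp add: full_row_def qsign_xor indep_xor)

text \<open>Three independent indices require three bits.\<close>

lemma no_indep: "n \<le> 2 \<Longrightarrow> h < 2 ^ n \<Longrightarrow> i < 2 ^ n \<Longrightarrow> k < 2 ^ n \<Longrightarrow> \<not> indep h i k"
proof
  assume "n \<le> 2" "h < 2 ^ n" "i < 2 ^ n" "k < 2 ^ n" and ind: "indep h i k"
  moreover have "(2::nat) ^ n \<le> 2 ^ 2" using \<open>n \<le> 2\<close> by (intro power_increasing) auto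
  ultimately have "h \<in> {1,2,3}" "i \<in> {1,2,3}" "k \<in> {1,2,3}" by (auto simp: indep_def)
  then show False using ind by (auto simp: indep_def)
qed

text \<open>A triple with dependent lower parts takes the value in question. This keeps generic
  degrees below the maximum and destroys full rows when \<open>h\<close> receives a new top
  bit.\<close>

lemma indep_ex:
  assumes "2 \<le> n" "h < 2 ^ Suc n" "i < 2 ^ Suc n" "h \<noteq> 0" "i \<noteq> 0" "i \<noteq> h"
  shows "\<exists>k<2 ^ Suc n. indep h i k \<and> F (Suc n) h i k = - \<nu> (Suc n) h"
proof -
  have ex: "\<exists>k<2 ^ n. k \<noteq> 0 \<and> k \<noteq> a" for a :: nat
  proof -
    have "(2::nat) ^ 2 \<le> 2 ^ n" using assms(1) by (intro power_increasing) auto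
    then show ?thesis by (intro exI[of _ "if a = 1 then 2 else 1"]) auto
  qed
  from assms(2) show ?thesis
  proof (elim less_exp_Suc_cases)
    assume h: "h < 2 ^ n"
    obtain i' where i: "i' < 2 ^ n" "i = i' \<or> i = i' + 2 ^ n"
      using assms(3) by (rule less_exp_Suc_low)
    show ?thesis
    proof (cases "i' = 0 \<or> i' = h")
      case True
      obtain k where k: "k < 2 ^ n" "k \<noteq> 0" "k \<noteq> h" using ex by blast
      have "indep h i k" using True k i h assms by (auto simp: indep_def)
      moreover have "\<not> indep h i' k" using True by (auto simp: indep_def)
      ultimately show ?thesis
        using qsign_Suc_degenerate[of h n i' k i k] k i h by (intro exI[of _ k]) auto
    next
      case False
      \<comment> \<open>The witness \<open>2 ^ n\<close> has lower part 0, so the lower parts are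
        dependent.\<close>
      have "i' XOR h \<noteq> 2 ^ n" using xor_less_exp[OF i(1) h] by simp
      then have "indep h i (2 ^ n)" using False i h assms by (auto simp: indep_def)
      moreover have "\<not> indep h i' 0" by (auto simp: indep_def)
      ultimately show ?thesis
        using qsign_Suc_degenerate[of h n i' 0 i "2 ^ n"] i h by (intro exI[of _ "2 ^ n"]) auto
    qed
  next
    fix h' assume h: "h' < 2 ^ n" "h = h' + 2 ^ n"
    have *: "\<exists>k<2 ^ Suc n. indep h i k \<and> F (Suc n) h i k = - \<nu> (Suc n) h" if "i < 2 ^ n" "i \<noteq> 0" for i
    proof -
      \<comment> \<open>If \<open>h'\<close> is neither 0 nor \<open>i\<close>, then
        \<open>k = h'\<close> serves; otherwise any \<open>k\<close> other than 0 and
        \<open>i\<close> does.\<close>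
      obtain k where "k < 2 ^ n" "k \<noteq> 0" "k \<noteq> i" "\<not> indep h' i k"
        using ex[of i] h that by (cases "h' = 0 \<or> h' = i") (auto simp: indep_def)
      then show ?thesis using that h qsign_Suc_degenerate_top[of h' n i k]
        by (intro exI[of _ k]) (auto simp: indep_def)
    qed
    from assms(3) show ?thesis
    proof (elim less_exp_Suc_cases)
      assume "i < 2 ^ n"
      then show ?thesis using *[of i] assms(5) by auto
    next
      fix i' assume "i' < 2 ^ n" "i = i' + 2 ^ n"
      then have "i XOR h < 2 ^ n" "i XOR h \<noteq> 0" using h assms by auto
      from *[OF this] show ?thesis by (simp only: indep_xor qsign_xor)
    qed
  qed
qed

text \<open>While \<open>h\<close> lacks the top bit, dependent lower parts give the value at once
  and independent ones by induction. When \<open>h\<close> has it, the lower part of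
  \<open>h\<close> is 0 or at most two lower bits exist, so lower parts are always
  dependent.\<close>

lemma full_row_special:
  assumes "h < 8 \<or> h = 2 ^ m" "h < 2 ^ n" "i < 2 ^ n" "k < 2 ^ n" "indep h i k"
  shows "F n h i k = - \<nu> n h"
  using assms(2-)
proof (induction n arbitrary: i k)
  case (Suc n)
  from Suc.prems(1) show ?case
  proof (elim less_exp_Suc_cases)
    assume h: "h < 2 ^ n"
    obtain i' where i: "i' < 2 ^ n" "i = i' \<or> i = i' + 2 ^ n"
      using Suc.prems(2) by (rule less_exp_Suc_low)
    obtain k' where k: "k' < 2 ^ n" "k = k' \<or> k = k' + 2 ^ n"
      using Suc.prems(3) by (rule less_exp_Suc_low)
    show ?thesis
    proof (cases "indep h i' k'")
      case True
      then show ?thesis using Suc.IH[of i' k'] qsign_Suc[of h i' k' n] h i k by auto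
    next
      case False
      then show ?thesis using qsign_Suc_degenerate[of h n i' k' i k] h i k Suc.prems by auto
    qed
  next
    fix h' assume h: "h' < 2 ^ n" "h = h' + 2 ^ n"
    have nind: "\<not> indep h' a b" if "a < 2 ^ n" "b < 2 ^ n" for a b
    proof (cases "h < 8")
      case True
      then have "(2::nat) ^ n < 2 ^ 3" using h by simp
      then have "n \<le> 2" using power_less_imp_less_exp[of "2::nat" n 3] by simp
      then show ?thesis using no_indep h that by blast
    next
      case False
      then have hm: "h = 2 ^ m" using assms(1) by simp
      then have "(2::nat) ^ m < 2 ^ Suc n" using h by simp
      moreover have "2 ^ n \<le> (2::nat) ^ m" using h hm by linarith
      ultimately have "m = n" by (metis le_antisym less_Suc_eq_le one_less_numeral_iff power_increasing_iff
        power_strict_increasing_iff semiring_norm(76))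
      then show ?thesis using False assms(1) h by (auto simp: indep_def)
    qed
    have *: "F (Suc n) h i k = - \<nu> (Suc n) h" if "indep h i k" "i < 2 ^ n" "k < 2 ^ n" for i k
      using qsign_Suc_degenerate_top[of h' n i k] that nind[of i k] h by (auto simp: indep_def)
    have **: "F (Suc n) h i k = - \<nu> (Suc n) h" if "indep h i k" "i < 2 ^ Suc n" "k < 2 ^ n" for i k
      using that(2)
    proof (elim less_exp_Suc_cases)
      fix i' assume "i' < 2 ^ n" "i = i' + 2 ^ n"
      \<comment> \<open>Since \<open>h\<close> has the top bit, \<open>i XOR h\<close> lacks it, and
        \<open>qsign\<close> is unchanged.\<close>
      then have "i XOR h < 2 ^ n" using h by simp
      then have "F (Suc n) h (i XOR h) k = - \<nu> (Suc n) h" using * that by (simp only: indep_xor)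
      then show ?thesis by (simp only: qsign_xor)
    qed (use * that in auto)
    from Suc.prems(3) show ?thesis
    proof (elim less_exp_Suc_cases)
      fix k' assume k: "k' < 2 ^ n" "k = k' + 2 ^ n"
      then have "k XOR h < 2 ^ n" using h by simp
      moreover have ind: "indep h i (k XOR h)" using Suc.prems by (simp only: indep_xor)
      ultimately have "F (Suc n) h i (k XOR h) = - \<nu> (Suc n) h" using ** Suc.prems by blast
      moreover have "F (Suc n) h (k XOR h) i = F (Suc n) h i (k XOR h)"
        using ind Suc.prems xor_less_exp by (intro qsign_sym) blast+
      ultimately show ?thesis using Suc.prems by (simp only: qsign_xor qsign_sym)
    qed (use ** Suc.prems in auto)
  qed
qed (simp add: indep_def)

lemma full_rows_special:
  assumes "h < 8 \<or> h = 2 ^ m" "h < 2 ^ n" "h \<noteq> 0"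
  shows "card (full_rows n h) = 2 ^ n - 2"
proof -
  have "full_rows n h = {..<2 ^ n} - {0, h}"
    using full_row_special[OF assms(1)] assms by (auto simp: full_rows_def full_row_def)
  then show ?thesis using assms by (simp add: card_Diff_subset)
qed

text \<open>Dependent lower parts always give minus the norm, so a row can fail only at a triple
  that is independent one level below, where the value is inherited.\<close>

lemma full_row_Suc:
  assumes "h < 2 ^ n" "h \<noteq> 0" "i < 2 ^ n" "I = i \<or> I = i + 2 ^ n"
  shows "full_row (Suc n) h I \<longleftrightarrow> i = 0 \<or> i = h \<or> full_row n h i"
proof (intro iffI)
  assume *: "full_row (Suc n) h I"
  show "i = 0 \<or> i = h \<or> full_row n h i"
  proof (rule ccontr)
    assume "\<not> (i = 0 \<or> i = h \<or> full_row n h i)"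
    then obtain k where k: "k < 2 ^ n" "indep h i k" "F n h i k \<noteq> - \<nu> n h" "i \<noteq> 0" "i \<noteq> h"
      by (auto simp: full_row_def)
    then have "indep h I k" using assms by (auto simp: indep_def)
    then show False using * k assms qsign_Suc[of h i k n] by (auto simp: full_row_def)
  qed
next
  assume *: "i = 0 \<or> i = h \<or> full_row n h i"
  have "F (Suc n) h I K = - \<nu> (Suc n) h" if K: "K < 2 ^ Suc n" "indep h I K" for K
  proof -
    obtain k where k: "k < 2 ^ n" "K = k \<or> K = k + 2 ^ n"
      using K(1) by (rule less_exp_Suc_low)
    show ?thesis
    proof (cases "indep h i k")
      case True
      then have "full_row n h i" using * by (auto simp: indep_def)
      then show ?thesis using True k assms qsign_Suc[of h i k n] by (auto simp: full_row_def)
    next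
      case False
      then show ?thesis using qsign_Suc_degenerate[of h n i k I K] K k assms by auto
    qed
  qed
  then show "full_row (Suc n) h I" by (simp add: full_row_def)
qed

text \<open>The lower half repeats the old full rows; the upper half repeats them too and adds the
  two rows over 0 and \<open>h\<close>.\<close>

lemma card_full_rows_Suc:
  assumes "h < 2 ^ n" "h \<noteq> 0"
  shows "card (full_rows (Suc n) h) = 2 * card (full_rows n h) + 2"
proof -
  let ?S = "full_rows n h"
  have fin: "finite ?S" by (simp add: full_rows_def)
  have "full_rows (Suc n) h = ?S \<union> (\<lambda>i. i + 2 ^ n) ` (?S \<union> {0, h})" (is "_ = ?R")
  proof (intro set_eqI)
    fix I
    show "I \<in> full_rows (Suc n) h \<longleftrightarrow> I \<in> ?R"
    proof (cases "I < 2 ^ Suc n")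
      case True
      then obtain i where i: "i < 2 ^ n" "I = i \<or> I = i + 2 ^ n" by (rule less_exp_Suc_low)
      then show ?thesis using full_row_Suc[OF assms i] assms by (auto simp: full_rows_def)
    qed (use assms in \<open>auto simp: full_rows_def\<close>)
  qed
  also have "card \<dots> = card ?S + card ((\<lambda>i. i + 2 ^ n) ` (?S \<union> {0, h}))"
    using fin by (intro card_Un_disjoint) (auto simp: full_rows_def)
  also have "card ((\<lambda>i. i + 2 ^ n) ` (?S \<union> {0, h})) = card (?S \<union> {0, h})"
    by (rule card_image) (auto simp: inj_on_def)
  also have "card (?S \<union> {0, h}) = card ?S + card {0, h}"
    using fin by (intro card_Un_disjoint) (auto simp: full_rows_def)
  finally show ?thesis using assms by simp
qed

text \<open>The new bit of \<open>h\<close> multiplies the independent values by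
  \<open>\<gamma> n\<close> but turns \<open>- \<nu> n h\<close> into
  \<open>\<gamma> n * \<nu> n h\<close>. So the value \<open>- \<nu> n h\<close> found by
  \<open>indep_ex\<close> spoils every row except \<open>h\<close> and its translate
  \<open>2 ^ n = h XOR (h + 2 ^ n)\<close>, for which lower parts are never independent.\<close>

lemma full_rows_top:
  assumes "3 \<le> n" "h < 2 ^ n" "h \<noteq> 0"
  shows "full_rows (Suc n) (h + 2 ^ n) = {h, 2 ^ n}"
proof -
  let ?H = "h + 2 ^ n"
  have eq: "\<nu> (Suc n) ?H = - (\<gamma> n * \<nu> n h)" using assms by simp
  have low: "full_row (Suc n) ?H i \<longleftrightarrow> i = h" if i: "i < 2 ^ n" "i \<noteq> 0" for i
  proof
    assume *: "full_row (Suc n) ?H i"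
    show "i = h"
    proof (rule ccontr)
      assume "i \<noteq> h"
      moreover obtain n' where "n = Suc n'" "2 \<le> n'" using assms(1) by (cases n) auto
      ultimately obtain k where k: "k < 2 ^ n" "indep h i k" "F n h i k = - \<nu> n h"
        using indep_ex[of n' h i] assms i by auto
      have "indep ?H i k" using k(1,2) assms i by (auto simp: indep_def)
      then have "F (Suc n) ?H i k = - \<nu> (Suc n) ?H" using * k by (auto simp: full_row_def)
      moreover have "F (Suc n) ?H i k = \<gamma> n * F n h i k" using k i assms qsign_Suc(5) by blast
      ultimately show False using eq k(3) sign[of n] \<nu>_cases[of n h] by auto
    qed
  next
    assume "i = h"
    have *: "F (Suc n) ?H h k = - \<nu> (Suc n) ?H" if "k < 2 ^ n" "indep ?H h k" for k
      using qsign_Suc_degenerate_top[of h n h k] that assms by (auto simp: indep_def)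
    have "F (Suc n) ?H h K = - \<nu> (Suc n) ?H" if K: "K < 2 ^ Suc n" "indep ?H h K" for K
      using K(1)
    proof (elim less_exp_Suc_cases)
      fix k assume k: "k < 2 ^ n" "K = k + 2 ^ n"
      have "K XOR ?H < 2 ^ n" using k assms by simp
      moreover have "indep ?H h (K XOR ?H)" using K(2) by (simp add: indep_xor)
      ultimately have "F (Suc n) ?H h (K XOR ?H) = - \<nu> (Suc n) ?H" by (rule *)
      moreover have "F (Suc n) ?H (K XOR ?H) h = F (Suc n) ?H h (K XOR ?H)"
        by (rule qsign_sym)
          (use K assms xor_less_exp[of K "Suc n" ?H] in \<open>simp_all add: indep_xor\<close>)
      ultimately have "F (Suc n) ?H (K XOR ?H) h = - \<nu> (Suc n) ?H" by simp
      then show ?thesis using qsign_sym[of ?H h K "Suc n"] K assms by (simp add: qsign_xor)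
    qed (use * K in auto)
    then show "full_row (Suc n) ?H i" using \<open>i = h\<close> by (simp add: full_row_def)
  qed
  show ?thesis
  proof (intro set_eqI)
    fix I
    show "I \<in> full_rows (Suc n) ?H \<longleftrightarrow> I \<in> {h, 2 ^ n}"
    proof (cases "I < 2 ^ Suc n")
      case True
      then show ?thesis
      proof (elim less_exp_Suc_cases)
        fix i assume i: "i < 2 ^ n" "I = i + 2 ^ n"
        then have "I XOR ?H = i XOR h" using assms by simp
        then have "full_row (Suc n) ?H I = full_row (Suc n) ?H (i XOR h)"
          using full_row_xor[of "Suc n" ?H I] by simp
        then show ?thesis using low[of "i XOR h"] i assms by (auto simp: full_rows_def)
      qed (use low assms in \<open>auto simp: full_rows_def\<close>)
    qed (use assms in \<open>auto simp: full_rows_def\<close>)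
  qed
qed

text \<open>By the recursion \<open>2 * c + 2\<close>, the number \<open>c + 2\<close> doubles at
  each level, starting from 4 at level \<open>m + 1\<close>.\<close>

lemma card_full_rows:
  assumes "3 \<le> m" "m < n" "h < 2 ^ m" "h \<noteq> 0"
  shows "card (full_rows n (h + 2 ^ m)) + 2 = 2 ^ (n - m + 1)"
proof -
  from \<open>m < n\<close> have "Suc m \<le> n" by simp
  then show ?thesis
  proof (induction n rule: dec_induct)
    case base
    show ?case using full_rows_top[of m h] assms by simp
  next
    case (step n)
    have "(2::nat) ^ Suc m \<le> 2 ^ n" using step by (intro power_increasing) auto
    then have "h + 2 ^ m < 2 ^ n" using assms by simp
    then show ?case using step card_full_rows_Suc[of "h + 2 ^ m" n] by (simp add: Suc_diff_le)
  qed
qed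

end

subsection \<open>Orthogonality of the generators\<close>

lemma cd_scale_simps [simp]:
  "cd_scale 1 x = x" "cd_scale 0 x = 0" "cd_scale t 0 = 0" "cd_scale s (cd_scale t x) = cd_scale (s * t) x"
  "cd_scale (-1) x = - x"
  by (auto simp: cd_scale_def fun_eq_iff)

lemma cd_pair_0 [simp]: "cd_pair k 0 0 = 0"
  by (auto simp: cd_pair_def fun_eq_iff)

lemma cd_scale_pair: "cd_scale t (cd_pair k a b) = cd_pair k (cd_scale t a) (cd_scale t b)"
  by (auto simp: cd_pair_def cd_scale_def fun_eq_iff)

lemma cd_fst_scale: "cd_fst k (cd_scale t x) = cd_scale t (cd_fst k x)"
  by (auto simp: cd_fst_def cd_scale_def fun_eq_iff)

lemma cd_snd_scale: "cd_snd k (cd_scale t x) = cd_scale t (cd_snd k x)"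
  by (auto simp: cd_snd_def cd_scale_def fun_eq_iff)

lemma cd_scale_add: "cd_scale t (x + y) = cd_scale t x + cd_scale t y"
  by (auto simp: cd_scale_def fun_eq_iff algebra_simps)

lemma cd_scale_minus: "cd_scale t (- x) = - cd_scale t x"
  by (auto simp: cd_scale_def fun_eq_iff)

lemma cd_conj_scale: "cd_conj n (cd_scale t x) = cd_scale t (cd_conj n x)"
  by (induction n arbitrary: x) (simp_all add: cd_fst_scale cd_snd_scale cd_scale_pair cd_scale_minus)

lemma cd_mult_scale:
  "cd_mult \<gamma> n (cd_scale t x) y = cd_scale t (cd_mult \<gamma> n x y)"
  "cd_mult \<gamma> n x (cd_scale t y) = cd_scale t (cd_mult \<gamma> n x y)"
proof (induction n arbitrary: x y)
  case 0
  { case 1 show ?case by (auto simp: cd_scale_def fun_eq_iff) }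
  { case 2 show ?case by (auto simp: cd_scale_def fun_eq_iff) }
next
  case (Suc n)
  { case 1 show ?case
      by (simp add: Let_def cd_fst_scale cd_snd_scale Suc cd_conj_scale cd_scale_pair cd_scale_add mult_ac) }
  { case 2 show ?case
      by (simp add: Let_def cd_fst_scale cd_snd_scale Suc cd_conj_scale cd_scale_pair cd_scale_add mult_ac) }
qed

lemma cd_mult_0 [simp]: "cd_mult \<gamma> n 0 y = 0" "cd_mult \<gamma> n x 0 = 0"
  using cd_mult_scale(1)[of \<gamma> n 0 0 y] cd_mult_scale(2)[of \<gamma> n x 0 0] by simp_all

lemma cd_conj_0 [simp]: "cd_conj n 0 = 0"
  using cd_conj_scale[of n 0] by auto

lemma cd_carrier_intros [simp]:
  "0 \<in> cd_carrier n" "x \<in> cd_carrier n \<Longrightarrow> cd_scale t x \<in> cd_carrier n"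
  "x \<in> cd_carrier n \<Longrightarrow> - x \<in> cd_carrier n"
  "x \<in> cd_carrier n \<Longrightarrow> y \<in> cd_carrier n \<Longrightarrow> x + y \<in> cd_carrier n"
  by (auto simp: cd_carrier_def cd_scale_def)

lemma cd_basis_carrier [simp]: "i < 2 ^ n \<Longrightarrow> cd_basis n i \<in> cd_carrier n"
  by (auto simp: cd_carrier_def cd_basis_eq)

lemma cd_pair_carrier [simp]:
  "a \<in> cd_carrier n \<Longrightarrow> b \<in> cd_carrier n \<Longrightarrow> cd_pair n a b \<in> cd_carrier (Suc n)"
  unfolding cd_carrier_Suc by blast

lemma cd_conj_basis: "i < 2 ^ n \<Longrightarrow> cd_conj n (cd_basis n i) = cd_scale (csign i) (cd_basis n i)"
proof (induction n arbitrary: i)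
  case (Suc n)
  from Suc.prems show ?case
    by (elim less_exp_Suc_cases)
      (auto simp: cd_fst_pair cd_snd_pair cd_scale_pair Suc.IH csign_def
        simp flip: cd_scale_simps(5))
qed (simp add: csign_def)

lemma cd_mult_basis:
  assumes "i < 2 ^ n" "j < 2 ^ n"
  shows "cd_mult \<gamma> n (cd_basis n i) (cd_basis n j) = cd_scale (bsign \<gamma> n i j) (cd_basis n (i XOR j))"
  using assms
proof (induction n arbitrary: i j)
  case 0
  then show ?case by auto
next
  case (Suc n)
  from Suc.prems show ?case
    by (elim less_exp_Suc_cases)
      (auto simp: cd_fst_pair cd_snd_pair cd_conj_basis cd_mult_scale cd_scale_pair Suc.IH
        xor.commute Let_def mult_ac)
qed

section \<open>Generators and the condition for their orthogonality\<close>

definition gen :: "nat \<Rightarrow> nat \<Rightarrow> nat \<Rightarrow> real \<Rightarrow> vec" where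
  "gen n i j s = cd_pair n (cd_basis n i) (cd_scale s (cd_basis n j))"

lemma gen_carrier: "i < 2 ^ n \<Longrightarrow> j < 2 ^ n \<Longrightarrow> gen n i j s \<in> cd_carrier (Suc n)"
  by (simp add: gen_def)

lemma gen_apply:
  assumes "i < 2 ^ n" "j < 2 ^ n"
  shows "gen n i j s p = (if p = i then 1 else if p = j + 2 ^ n then s else 0)"
  using assms by (auto simp: gen_def cd_pair_def cd_basis_eq cd_scale_def)

lemma gen_nonzero: "i < 2 ^ n \<Longrightarrow> j < 2 ^ n \<Longrightarrow> gen n i j s \<noteq> 0"
  using gen_apply[of i n j s i] by (metis zero_fun_apply zero_neq_one)

text \<open>The coefficient 1 in the first component fixes the scalar between two generators of one
  line.\<close>

lemma line_gen_inj:
  assumes "line (gen n i j s) = line (gen n k l t)"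
    and "i < 2 ^ n" "j < 2 ^ n" "k < 2 ^ n" "l < 2 ^ n" and "s \<noteq> 0" "t \<noteq> 0"
  shows "i = k \<and> j = l \<and> s = t"
proof -
  have "gen n i j s \<in> line (gen n i j s)"
    unfolding line_def using cd_scale_simps(1) by (metis (mono_tags, lifting) mem_Collect_eq)
  then obtain c where "gen n i j s = cd_scale c (gen n k l t)"
    using assms(1) by (auto simp: line_def)
  then have *: "gen n i j s p = c * gen n k l t p" for p by (simp add: cd_scale_def)
  have "k = i" using *[of i] assms by (auto simp: gen_apply split: if_splits)
  moreover from this have "c = 1" using *[of i] assms by (auto simp: gen_apply)
  moreover have "j = l" using *[of "j + 2 ^ n"] assms by (auto simp: gen_apply split: if_splits)
  ultimately show ?thesis using *[of "j + 2 ^ n"] assms by (auto simp: gen_apply split: if_splits)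
qed

lemma cd_pair_eq_0_iff:
  "a \<in> cd_carrier n \<Longrightarrow> b \<in> cd_carrier n \<Longrightarrow> cd_pair n a b = 0 \<longleftrightarrow> a = 0 \<and> b = 0"
  by (metis cd_fst_pair cd_snd_pair cd_pair_0 cd_carrier_intros(1))

lemma basis_combination_eq_0_iff:
  assumes "p < 2 ^ n" "q < 2 ^ n"
  shows "cd_scale a (cd_basis n p) + cd_scale b (cd_basis n q) = 0 \<longleftrightarrow>
    (if p = q then a + b = 0 else a = 0 \<and> b = 0)"
  using assms by (auto simp: cd_basis_eq cd_scale_def fun_eq_iff split: if_splits)

lemma cd_mult_gen:
  assumes "i < 2 ^ n" "j < 2 ^ n" "k < 2 ^ n" "l < 2 ^ n"
  shows "cd_mult \<gamma> (Suc n) (gen n i j s) (gen n k l t) =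
    cd_pair n
      (cd_scale (bsign \<gamma> n i k) (cd_basis n (i XOR k)) +
       cd_scale (\<gamma> n * csign l * t * s * bsign \<gamma> n l j) (cd_basis n (l XOR j)))
      (cd_scale (t * bsign \<gamma> n l i) (cd_basis n (l XOR i)) +
       cd_scale (s * csign k * bsign \<gamma> n j k) (cd_basis n (j XOR k)))"
  unfolding gen_def using assms
  by (simp add: cd_mult_pair cd_conj_basis cd_conj_scale cd_mult_scale cd_mult_basis mult_ac
    del: cd_mult.simps)

context sign_params
begin

lemma \<sigma>_nonzero [simp]: "\<sigma> n i j \<noteq> 0"
  using \<sigma>_cases[of n i j] by auto

text \<open>In both components the two basis indices agree exactly when
  \<open>i XOR j = k XOR l\<close>; if they differ, the coefficient \<open>\<sigma> n i k\<close>
  keeps the first component nonzero. The second condition has no conjugation sign because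
  \<open>csign k = -1\<close>.\<close>

lemma gen_mult_eq_0_iff:
  assumes "i < 2 ^ n" "j < 2 ^ n" "k < 2 ^ n" "l < 2 ^ n" "k \<noteq> 0"
  shows "cd_mult \<gamma> (Suc n) (gen n i j s) (gen n k l t) = 0 \<longleftrightarrow>
    i XOR j = k XOR l \<and> t * \<sigma> n l i = s * \<sigma> n j k \<and>
    \<sigma> n i k + \<gamma> n * csign l * t * s * \<sigma> n l j = 0"
proof -
  have "i XOR k = l XOR j \<longleftrightarrow> i XOR j = k XOR l" "l XOR i = j XOR k \<longleftrightarrow> i XOR j = k XOR l"
    by (metis xor.commute xor.assoc xor_self_left)+
  then show ?thesis
    using assms by (subst cd_mult_gen) (auto simp: cd_pair_eq_0_iff basis_combination_eq_0_iff csign_def)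
qed

text \<open>One vanishing product implies the other: swapping the factors keeps the second condition
  and, by anticommutativity, negates both terms of the third, unless \<open>i = k\<close> and
  \<open>j = l\<close>, when nothing changes.\<close>

lemma orthogonal_gen_iff:
  assumes "i < 2 ^ n" "j < 2 ^ n" "k < 2 ^ n" "l < 2 ^ n" "i \<noteq> 0" "k \<noteq> 0"
  shows "cd_orthogonal \<gamma> (Suc n) (gen n i j s) (gen n k l t) \<longleftrightarrow>
    i XOR j = k XOR l \<and> t * \<sigma> n l i = s * \<sigma> n j k \<and>
    \<sigma> n i k + \<gamma> n * csign l * t * s * \<sigma> n l j = 0"
proof -
  have "\<sigma> n k i + \<gamma> n * csign j * s * t * \<sigma> n j l = 0 \<longleftrightarrow>
      \<sigma> n i k + \<gamma> n * csign l * t * s * \<sigma> n l j = 0" if h: "i XOR j = k XOR l"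
  proof (cases "i = k")
    case True
    then show ?thesis using h by (simp add: mult_ac)
  next
    case False
    then have "j \<noteq> l" using h by auto
    have eq: "csign j * \<sigma> n j l = - (csign l * \<sigma> n l j)"
    proof (cases "j = 0 \<or> l = 0")
      case False
      then show ?thesis using \<sigma>_anticomm[of j n l] assms \<open>j \<noteq> l\<close> by (auto simp: csign_def)
    qed (use assms \<open>j \<noteq> l\<close> in \<open>auto simp: csign_def\<close>)
    have "\<gamma> n * csign j * s * t * \<sigma> n j l = \<gamma> n * s * t * (csign j * \<sigma> n j l)"
      by (simp add: mult_ac)
    also have "\<dots> = - (\<gamma> n * csign l * t * s * \<sigma> n l j)"
      unfolding eq by (simp add: mult_ac)
    finally have "\<gamma> n * csign j * s * t * \<sigma> n j l = - (\<gamma> n * csign l * t * s * \<sigma> n l j)" .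
    moreover have "\<sigma> n k i = - \<sigma> n i k" using assms False by (intro \<sigma>_anticomm) auto
    ultimately show ?thesis by linarith
  qed
  then show ?thesis
    unfolding cd_orthogonal_def using assms by (auto simp: gen_mult_eq_0_iff simp del: cd_mult.simps)
qed

text \<open>The indices over which \<open>(h, i, s)\<close> has a neighbour; eliminating the forced
  sign removes \<open>s\<close>. Excluding \<open>k = i\<close> reflects that adjacent lines are
  distinct, as the sign forced over \<open>i\<close> is \<open>s\<close> itself.\<close>

definition nbr :: "nat \<Rightarrow> nat \<Rightarrow> nat \<Rightarrow> nat set" where
  "nbr n h i = {k. k < 2 ^ n \<and> k \<noteq> 0 \<and> k \<noteq> i \<and>
    \<sigma> n i k + \<gamma> n * csign (k XOR h) * \<sigma> n (k XOR h) i * \<sigma> n (i XOR h) k * \<sigma> n (k XOR h) (i XOR h) = 0}"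

text \<open>The sign that a neighbour over \<open>k\<close> of \<open>(h, i, s)\<close> is forced to carry is \<open>s * twist n h i k\<close>.\<close>

definition twist :: "nat \<Rightarrow> nat \<Rightarrow> nat \<Rightarrow> nat \<Rightarrow> real" where
  "twist n h i k = \<sigma> n (k XOR h) i * \<sigma> n (i XOR h) k"

text \<open>Candidates for vertices, indexed by the invariant \<open>h\<close> first. A candidate is
  shown to be a zero divisor only through an orthogonal partner.\<close>

definition vindex :: "nat \<Rightarrow> (nat \<times> nat \<times> real) set" where
  "vindex n = {..<2 ^ n} \<times> ({..<2 ^ n} - {0}) \<times> {1, -1}"

definition vert :: "nat \<Rightarrow> nat \<times> nat \<times> real \<Rightarrow> vec set" where
  "vert n = (\<lambda>(h, i, s). line (gen n i (i XOR h) s))"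

lemma vert_inj: "inj_on (vert n) (vindex n)"
proof (rule inj_onI)
  fix x y assume "x \<in> vindex n" "y \<in> vindex n" "vert n x = vert n y"
  moreover obtain h i s where "x = (h, i, s)" by (cases x)
  moreover obtain h' i' s' where "y = (h', i', s')" by (cases y)
  ultimately show "x = y"
    using line_gen_inj[of n i "i XOR h" s i' "i' XOR h'" s'] by (auto simp: vindex_def vert_def)
qed

lemma Gamma_gens_form:
  assumes "u \<in> Gamma_gens \<gamma> n"
  obtains h i s where "(h, i, s) \<in> vindex n" "u = gen n i (i XOR h) s"
proof -
  obtain a b where u: "u = cd_pair n a b" "a \<in> std_basis' n" "b \<in> std_basis n \<union> uminus ` std_basis n"
    using assms by (auto simp: Gamma_gens_def)
  obtain i where i: "i < 2 ^ n" "i \<noteq> 0" "a = cd_basis n i"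
    using u by (auto simp: std_basis'_def std_basis_def)
  obtain j s where j: "j < 2 ^ n" "s = 1 \<or> s = -1" "b = cd_scale s (cd_basis n j)"
  proof -
    from u(3) consider j where "j < 2 ^ n" "b = cd_basis n j" | j where "j < 2 ^ n" "b = - cd_basis n j"
      by (auto simp: std_basis_def)
    then show ?thesis by cases (use that[of _ 1] that[of _ "-1"] in auto)
  qed
  show ?thesis
    using that[of "i XOR j" i s] i j u by (auto simp: gen_def vindex_def)
qed

lemma gen_in_Gamma_gens:
  assumes "(h, i, s) \<in> vindex n" "(h', k, t) \<in> vindex n"
    and "cd_orthogonal \<gamma> (Suc n) (gen n i (i XOR h) s) (gen n k (k XOR h') t)"
  shows "gen n i (i XOR h) s \<in> Gamma_gens \<gamma> n" "gen n k (k XOR h') t \<in> Gamma_gens \<gamma> n"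
proof -
  have std: "cd_basis n i \<in> std_basis' n" if "i < 2 ^ n" "i \<noteq> 0" for i
  proof -
    have "cd_basis n i \<noteq> cd_basis n 0"
      using that by (auto simp: cd_basis_eq fun_eq_iff)
    then show ?thesis using that by (auto simp: std_basis'_def std_basis_def)
  qed
  have sgn: "cd_scale s (cd_basis n j) \<in> std_basis n \<union> uminus ` std_basis n"
    if "j < 2 ^ n" "s = 1 \<or> s = -1" for s j
    using that by (auto simp: std_basis_def)
  have less: "i < 2 ^ n" "i XOR h < 2 ^ n" "k < 2 ^ n" "k XOR h' < 2 ^ n"
    using assms by (auto simp: vindex_def)
  have z: "cd_zero_divisor \<gamma> (Suc n) (gen n i (i XOR h) s)"
    "cd_zero_divisor \<gamma> (Suc n) (gen n k (k XOR h') t)"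
    unfolding cd_zero_divisor_def
    using assms(3)[unfolded cd_orthogonal_def] gen_carrier[OF less(1,2)] gen_carrier[OF less(3,4)]
      gen_nonzero[OF less(1,2)] gen_nonzero[OF less(3,4)] by blast+
  show "gen n i (i XOR h) s \<in> Gamma_gens \<gamma> n"
    unfolding Gamma_gens_def
    by (rule CollectI, rule exI[of _ "cd_basis n i"], rule exI[of _ "cd_scale s (cd_basis n (i XOR h))"])
      (use assms std sgn z in \<open>auto simp: gen_def vindex_def\<close>)
  show "gen n k (k XOR h') t \<in> Gamma_gens \<gamma> n"
    unfolding Gamma_gens_def
    by (rule CollectI, rule exI[of _ "cd_basis n k"], rule exI[of _ "cd_scale t (cd_basis n (k XOR h'))"])
      (use assms std sgn z in \<open>auto simp: gen_def vindex_def\<close>)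
qed

text \<open>Injectivity of \<open>vert\<close> determines the generators from the lines, and
  orthogonality puts both into \<open>Gamma_gens\<close>. The sign \<open>t\<close> is then solved
  for, as \<open>s\<close> and the structure signs square to 1.\<close>

lemma Gamma_adj_iff:
  assumes "(h, i, s) \<in> vindex n" "(h', k, t) \<in> vindex n"
  shows "Gamma_adj \<gamma> n (vert n (h, i, s)) (vert n (h', k, t)) \<longleftrightarrow>
    h' = h \<and> k \<in> nbr n h i \<and> t = s * twist n h i k"
proof -
  let ?u = "gen n i (i XOR h) s" and ?v = "gen n k (k XOR h') t"
  have "Gamma_adj \<gamma> n (vert n (h, i, s)) (vert n (h', k, t)) \<longleftrightarrow>
      (h, i, s) \<noteq> (h', k, t) \<and> cd_orthogonal \<gamma> (Suc n) ?u ?v" (is "?A \<longleftrightarrow> ?B")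
  proof
    assume A: ?A
    then obtain u v where uv: "u \<in> Gamma_gens \<gamma> n" "v \<in> Gamma_gens \<gamma> n" "vert n (h, i, s) = line u"
      "vert n (h', k, t) = line v" "cd_orthogonal \<gamma> (Suc n) u v"
      by (auto simp: Gamma_adj_def)
    obtain x where x: "x \<in> vindex n" "u = (case x of (h, i, s) \<Rightarrow> gen n i (i XOR h) s)"
      using uv(1) by (rule Gamma_gens_form) auto
    obtain y where y: "y \<in> vindex n" "v = (case y of (h, i, s) \<Rightarrow> gen n i (i XOR h) s)"
      using uv(2) by (rule Gamma_gens_form) auto
    have "vert n x = vert n (h, i, s)" "vert n y = vert n (h', k, t)"
      using x y uv by (auto simp: vert_def split: prod.splits)
    then have "x = (h, i, s)" "y = (h', k, t)"
      using inj_onD[OF vert_inj] x y assms by blast+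
    then show ?B using x y uv A by (auto simp: Gamma_adj_def)
  next
    assume B: ?B
    then have "vert n (h, i, s) \<noteq> vert n (h', k, t)" using inj_onD[OF vert_inj] assms by blast
    then show ?A using gen_in_Gamma_gens[OF assms] B by (auto simp: Gamma_adj_def vert_def)
  qed
  also have "\<dots> \<longleftrightarrow> h' = h \<and> k \<in> nbr n h i \<and> t = s * twist n h i k"
  proof (cases "h' = h")
    case False
    then show ?thesis using assms by (auto simp: orthogonal_gen_iff vindex_def)
  next
    case h: True
    have less: "i < 2 ^ n" "i XOR h < 2 ^ n" "k < 2 ^ n" "k XOR h < 2 ^ n" "i \<noteq> 0" "k \<noteq> 0"
      using assms h by (auto simp: vindex_def)
    have s: "s * s = 1" using assms by (auto simp: vindex_def)
    have eq: "t * \<sigma> n (k XOR h) i = s * \<sigma> n (i XOR h) k \<longleftrightarrow> t = s * twist n h i k"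
    proof
      assume "t * \<sigma> n (k XOR h) i = s * \<sigma> n (i XOR h) k"
      then have "t * \<sigma> n (k XOR h) i * \<sigma> n (k XOR h) i = s * \<sigma> n (i XOR h) k * \<sigma> n (k XOR h) i" by simp
      then show "t = s * twist n h i k" by (simp add: twist_def mult_ac)
    qed (simp add: twist_def mult_ac)
    have ki: "k = i \<Longrightarrow> t = s * twist n h i k \<Longrightarrow> t = s" by (simp add: twist_def)
    have ss: "s * (s * x) = x" for x using s by (metis mult.assoc mult_1)
    show ?thesis
      unfolding h orthogonal_gen_iff[OF less] eq
      using less ki by (auto simp: nbr_def mult_ac twist_def ss)
  qed
  finally show ?thesis .
qed

lemma twist_cases: "twist n h i k = 1 \<or> twist n h i k = -1"
  using \<sigma>_cases[of n "k XOR h" i] \<sigma>_cases[of n "i XOR h" k] by (auto simp: twist_def)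

lemma vert_vindex_cases:
  assumes "L \<in> Gamma_verts \<gamma> n"
  obtains x where "x \<in> vindex n" "L = vert n x"
proof -
  obtain u where u: "u \<in> Gamma_gens \<gamma> n" "L = line u" using assms by (auto simp: Gamma_verts_def)
  obtain h i s where "(h, i, s) \<in> vindex n" "u = gen n i (i XOR h) s" using u(1) by (rule Gamma_gens_form)
  then show ?thesis using that[of "(h, i, s)"] u by (auto simp: vert_def)
qed

lemma Gamma_adj_verts:
  "Gamma_adj \<gamma> n L M \<Longrightarrow> L \<in> Gamma_verts \<gamma> n \<and> M \<in> Gamma_verts \<gamma> n"
  by (auto simp: Gamma_adj_def Gamma_verts_def)

lemma neighbours_vert:
  assumes "(h, i, s) \<in> vindex n"
  shows "{L \<in> Gamma_verts \<gamma> n. Gamma_adj \<gamma> n (vert n (h, i, s)) L} =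
    (\<lambda>k. vert n (h, k, s * twist n h i k)) ` nbr n h i" (is "?N = ?f ` _")
proof (intro set_eqI iffI)
  fix L assume L: "L \<in> ?N"
  then obtain x where "x \<in> vindex n" "L = vert n x" by (auto elim: vert_vindex_cases)
  moreover obtain h' k t where "x = (h', k, t)" by (cases x)
  ultimately show "L \<in> ?f ` nbr n h i" using L assms by (auto simp: Gamma_adj_iff)
next
  fix L assume "L \<in> ?f ` nbr n h i"
  then obtain k where k: "k \<in> nbr n h i" "L = ?f k" by blast
  then have "(h, k, s * twist n h i k) \<in> vindex n"
    using assms twist_cases[of n h i k] by (auto simp: vindex_def nbr_def)
  then have "Gamma_adj \<gamma> n (vert n (h, i, s)) L" using k assms Gamma_adj_iff by blast
  then show "L \<in> ?N" using Gamma_adj_verts by blast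
qed

lemma inj_on_neighbours:
  assumes "(h, i, s) \<in> vindex n"
  shows "inj_on (\<lambda>k. vert n (h, k, s * twist n h i k)) (nbr n h i)"
proof (rule inj_onI)
  fix k l assume *: "k \<in> nbr n h i" "l \<in> nbr n h i"
    "vert n (h, k, s * twist n h i k) = vert n (h, l, s * twist n h i l)"
  then have "(h, k, s * twist n h i k) \<in> vindex n" "(h, l, s * twist n h i l) \<in> vindex n"
    using assms twist_cases[of n h i k] twist_cases[of n h i l] by (auto simp: vindex_def nbr_def)
  then show "k = l" using inj_onD[OF vert_inj *(3)] by blast
qed

end

section \<open>Graph invariants built from degrees\<close>

definition degree :: "'a set \<Rightarrow> ('a \<Rightarrow> 'a \<Rightarrow> bool) \<Rightarrow> 'a \<Rightarrow> nat" where
  "degree V E v = card {w \<in> V. E v w}"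

definition count2 :: "'a set \<Rightarrow> ('a \<Rightarrow> 'a \<Rightarrow> bool) \<Rightarrow> 'a \<Rightarrow> nat" where
  "count2 V E v = card {w \<in> V. E v w \<and> degree V E w = 2}"

text \<open>The invariant from which all parameters are read off, with \<open>d\<close> the maximal
  degree \<open>2 ^ n - 2\<close>.\<close>

definition degree_stat :: "'a set \<Rightarrow> ('a \<Rightarrow> 'a \<Rightarrow> bool) \<Rightarrow> nat \<Rightarrow> nat \<Rightarrow> nat" where
  "degree_stat V E d r = card {v \<in> V. degree V E v = d \<and> count2 V E v = r}"

lemma degree_stat_isomorphic:
  assumes "graph_isomorphic V E W F"
  shows "degree_stat V E d r = degree_stat W F d r"
proof -
  obtain f where f: "bij_betw f V W" "\<And>x y. x \<in> V \<Longrightarrow> y \<in> V \<Longrightarrow> E x y \<longleftrightarrow> F (f x) (f y)"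
    using assms by (auto simp: graph_isomorphic_def)
  have transfer: "card {x \<in> V. P x} = card {y \<in> W. Q y}" if "\<And>x. x \<in> V \<Longrightarrow> P x \<longleftrightarrow> Q (f x)" for P Q
  proof -
    have "bij_betw f {x \<in> V. P x} {y \<in> W. Q y}"
      using f(1) that by (auto simp: bij_betw_def inj_on_def)
    then show ?thesis by (rule bij_betw_same_card)
  qed
  have d: "degree V E x = degree W F (f x)" if "x \<in> V" for x
    unfolding degree_def using f(2) that by (intro transfer) auto
  have c: "count2 V E x = count2 W F (f x)" if "x \<in> V" for x
    unfolding count2_def using f(2) that d by (intro transfer) auto
  show ?thesis
    unfolding degree_stat_def using d c by (intro transfer) auto
qed

context sign_params
begin

lemma degree_vert:
  assumes "(h, i, s) \<in> vindex n"
  shows "degree (Gamma_verts \<gamma> n) (Gamma_adj \<gamma> n) (vert n (h, i, s)) = card (nbr n h i)"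
  unfolding degree_def neighbours_vert[OF assms] by (rule card_image[OF inj_on_neighbours[OF assms]])

lemma count2_vert:
  assumes "(h, i, s) \<in> vindex n"
  shows "count2 (Gamma_verts \<gamma> n) (Gamma_adj \<gamma> n) (vert n (h, i, s)) =
    card {k \<in> nbr n h i. card (nbr n h k) = 2}"
proof -
  let ?f = "\<lambda>k. vert n (h, k, s * twist n h i k)"
  let ?D = "degree (Gamma_verts \<gamma> n) (Gamma_adj \<gamma> n)"
  have D: "?D (?f k) = card (nbr n h k)" if "k \<in> nbr n h i" for k
    by (rule degree_vert) (use that assms twist_cases[of n h i k] in \<open>auto simp: vindex_def nbr_def\<close>)
  have "{L \<in> Gamma_verts \<gamma> n. Gamma_adj \<gamma> n (vert n (h, i, s)) L \<and> ?D L = 2} =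
      {L \<in> ?f ` nbr n h i. ?D L = 2}"
    using neighbours_vert[OF assms] by blast
  also have "\<dots> = ?f ` {k \<in> nbr n h i. card (nbr n h k) = 2}"
    using D by auto
  finally show ?thesis
    unfolding count2_def
    using inj_on_subset[OF inj_on_neighbours[OF assms], of "{k \<in> nbr n h i. card (nbr n h k) = 2}"]
    by (simp add: card_image)
qed

text \<open>The factor 2 stands for the two signs \<open>s\<close>, which do not influence degrees.
  By \<open>d > 0\<close> every counted candidate has a neighbour, so it is a zero divisor and a
  vertex.\<close>

lemma degree_stat_Gamma:
  assumes "d > 0"
  shows "degree_stat (Gamma_verts \<gamma> n) (Gamma_adj \<gamma> n) d r =
    2 * card {(h, i). h < 2 ^ n \<and> i < 2 ^ n \<and> i \<noteq> 0 \<and> card (nbr n h i) = d \<and>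
      card {k \<in> nbr n h i. card (nbr n h k) = 2} = r}" (is "_ = 2 * card ?P")
proof -
  let ?V = "Gamma_verts \<gamma> n" and ?E = "Gamma_adj \<gamma> n"
  let ?g = "\<lambda>((h, i), s). vert n (h, i, s)"
  have inV: "vert n x \<in> ?V" if "x \<in> vindex n" "degree ?V ?E (vert n x) > 0" for x
  proof -
    have "{w \<in> ?V. ?E (vert n x) w} \<noteq> {}" using that(2) unfolding degree_def by (metis card.empty less_irrefl)
    then show ?thesis using Gamma_adj_verts by blast
  qed
  have "{v \<in> ?V. degree ?V ?E v = d \<and> count2 ?V ?E v = r} = ?g ` (?P \<times> {1, -1})" (is "?L = ?R")
  proof (intro set_eqI iffI)
    fix v assume v: "v \<in> ?L"
    then obtain x where x: "x \<in> vindex n" "v = vert n x" by (auto elim: vert_vindex_cases)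
    obtain h i s where hi: "x = (h, i, s)" by (cases x)
    have "((h, i), s) \<in> ?P \<times> {1, -1}"
      using v x hi by (auto simp: degree_vert count2_vert) (auto simp: vindex_def)
    then show "v \<in> ?R" using x hi by (intro image_eqI[of _ _ "((h, i), s)"]) auto
  next
    fix v assume "v \<in> ?R"
    then obtain h i s where v: "(h, i) \<in> ?P" "s \<in> {1, -1}" "v = vert n (h, i, s)" by auto
    then have "(h, i, s) \<in> vindex n" by (auto simp: vindex_def)
    then show "v \<in> ?L" using v inV assms by (auto simp: degree_vert count2_vert)
  qed
  moreover have "inj_on ?g (?P \<times> {1, -1})"
  proof (rule inj_onI)
    fix x y assume *: "x \<in> ?P \<times> {1, -1}" "y \<in> ?P \<times> {1, -1}" "?g x = ?g y"
    obtain h i s h' i' s' where xy: "x = ((h, i), s)" "y = ((h', i'), s')" by (metis surj_pair)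
    have "(h, i, s) \<in> vindex n" "(h', i', s') \<in> vindex n" using * xy by (auto simp: vindex_def)
    then show "x = y" using inj_onD[OF vert_inj, of n "(h, i, s)" "(h', i', s')"] * xy by auto
  qed
  ultimately have "degree_stat ?V ?E d r = card (?P \<times> {1, -1 :: real})"
    unfolding degree_stat_def by (simp add: card_image)
  then show ?thesis by (simp add: card_cartesian_product)
qed

section \<open>Explicit neighbour sets\<close>

lemma nbr_zero: "nbr n 0 i = (if \<gamma> n = 1 then {..<2 ^ n} - {0, i} else {})"
  if "i < 2 ^ n" "i \<noteq> 0"
proof -
  have "\<sigma> n i k + \<gamma> n * csign k * \<sigma> n k i * \<sigma> n i k * \<sigma> n k i = 0 \<longleftrightarrow> \<gamma> n = 1"
    if k: "k < 2 ^ n" "k \<noteq> 0" "k \<noteq> i" for k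
    using \<sigma>_cases[of n i k] sign[of n] k by (auto simp: csign_def mult_ac)
  then show ?thesis by (auto simp: nbr_def)
qed

text \<open>For \<open>i = h\<close> two of the signs involve index 0 and are 1; alternativity
  reduces the rest to a condition free of \<open>k\<close>.\<close>

lemma nbr_centre: "nbr n h h = (if \<nu> n h = \<gamma> n then {..<2 ^ n} - {0, h} else {})"
  if h: "h < 2 ^ n" "h \<noteq> 0"
proof -
  have "\<sigma> n h k + \<gamma> n * csign (k XOR h) * \<sigma> n (k XOR h) h * \<sigma> n 0 k * \<sigma> n (k XOR h) 0 = 0
      \<longleftrightarrow> \<nu> n h = \<gamma> n" if k: "k < 2 ^ n" "k \<noteq> 0" "k \<noteq> h" for k
  proof -
    have "\<sigma> n (k XOR h) h = - \<nu> n h * \<sigma> n k h"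
      using \<sigma>_right_alt[of h n k] k h by (metis \<sigma>_sq mult.commute)
    moreover have "\<sigma> n k h = - \<sigma> n h k" using k h by (intro \<sigma>_anticomm) auto
    ultimately show ?thesis
      using \<sigma>_cases[of n h k] sign[of n] \<nu>_cases[of n h] k h by (auto simp: csign_def)
  qed
  then show ?thesis by (auto simp: nbr_def)
qed

text \<open>Among the dependent indices only \<open>h\<close> and \<open>i XOR h\<close> are
  admissible; alternativity decides the first and the squares of basis units the second. For all
  others the condition is the value of \<open>qsign\<close>.\<close>

lemma nbr_generic:
  assumes "h < 2 ^ n" "h \<noteq> 0" "i < 2 ^ n" "i \<noteq> 0" "i \<noteq> h"
  shows "nbr n h i = {k. k < 2 ^ n \<and> indep h i k \<and> F n h i k = \<gamma> n} \<union>
    (if \<nu> n h = \<gamma> n then {h, i XOR h} else {})"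
proof -
  have ih: "i XOR h < 2 ^ n" using assms by simp
  have 1: "k \<in> nbr n h i \<longleftrightarrow> F n h i k = \<gamma> n" if k: "k < 2 ^ n" "indep h i k" for k
    using indep_anticomm(8)[OF k(2) assms(1,3) k(1)] k
      \<sigma>_cases[of n i k] \<sigma>_cases[of n "k XOR h" i] \<sigma>_cases[of n "i XOR h" k]
      \<sigma>_cases[of n "k XOR h" "i XOR h"] sign[of n]
    by (auto simp: nbr_def qsign_def indep_def)
  have "\<sigma> n (i XOR h) h = - \<nu> n h * \<sigma> n i h"
    using \<sigma>_right_alt[of h n i] assms by (metis \<sigma>_sq mult.commute)
  then have 2: "h \<in> nbr n h i \<longleftrightarrow> \<nu> n h = \<gamma> n"
    using assms ih \<sigma>_cases[of n i h] sign[of n] \<nu>_cases[of n h] by (auto simp: nbr_def)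
  have "\<sigma> n i i * \<sigma> n (i XOR h) (i XOR h) = \<nu> n h"
    using assms by (simp add: \<sigma>_self \<nu>_xor)
  then have 3: "i XOR h \<in> nbr n h i \<longleftrightarrow> \<nu> n h = \<gamma> n"
    using assms ih \<sigma>_cases[of n i "i XOR h"] sign[of n] \<nu>_cases[of n h] 
      \<sigma>_cases[of n i i] \<sigma>_cases[of n "i XOR h" "i XOR h"] by (auto simp: nbr_def csign_def)
  show ?thesis
  proof (intro set_eqI)
    fix k
    have "k \<in> nbr n h i \<Longrightarrow> k < 2 ^ n \<and> (indep h i k \<or> k = h \<or> k = i XOR h)"
      using assms by (auto simp: nbr_def indep_def)
    then show "k \<in> nbr n h i \<longleftrightarrow> k \<in> {k. k < 2 ^ n \<and> indep h i k \<and> F n h i k = \<gamma> n} \<union>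
        (if \<nu> n h = \<gamma> n then {h, i XOR h} else {})"
      using 1 2 3 by (auto simp: indep_def)
  qed
qed

end

subsection \<open>Vertices of maximal degree\<close>

lemma exp_ge_8: "3 \<le> n \<Longrightarrow> (8::nat) \<le> 2 ^ n"
  using power_increasing[of 3 n "2::nat"] by simp

lemma nat_top_bit:
  assumes "8 \<le> h" "h < 2 ^ n"
  obtains m h' where "3 \<le> m" "m < n" "h' < 2 ^ m" "(h::nat) = h' + 2 ^ m"
proof -
  have "\<exists>m h'. 3 \<le> m \<and> m < n \<and> h' < 2 ^ m \<and> h = h' + 2 ^ m"
    using assms(2)
  proof (induction n)
    case 0
    then show ?case using assms by simp
  next
    case (Suc n)
    from Suc.prems show ?case
    proof (elim less_exp_Suc_cases)
      assume "h < 2 ^ n"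
      then show ?thesis using Suc.IH less_SucI by blast
    next
      fix h' assume h: "h' < 2 ^ n" "h = h' + 2 ^ n"
      have "3 \<le> n"
      proof (rule ccontr)
        assume "\<not> 3 \<le> n"
        then have "(2::nat) ^ Suc n \<le> 2 ^ 3" by (intro power_increasing) auto
        then show False using Suc.prems assms(1) by simp
      qed
      then show ?thesis using h by blast
    qed
  qed
  then show ?thesis using that by blast
qed

context sign_params
begin

text \<open>One admissible index is missing: a \<open>k\<close> from \<open>indep_ex\<close> if
  \<open>\<nu> n h = \<gamma> n\<close>, and \<open>h\<close> otherwise.\<close>

lemma card_nbr_generic_less:
  assumes "3 \<le> n" "h < 2 ^ n" "h \<noteq> 0" "i < 2 ^ n" "i \<noteq> 0" "i \<noteq> h"
  shows "card (nbr n h i) < 2 ^ n - 2"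
proof -
  obtain n' where n': "n = Suc n'" "2 \<le> n'" using assms(1) by (cases n) auto
  then obtain k where k: "k < 2 ^ n" "indep h i k" "F n h i k = - \<nu> n h"
    using indep_ex[of n' h i] assms by auto
  have "k \<notin> nbr n h i" if "\<nu> n h = \<gamma> n"
    unfolding nbr_generic[OF assms(2-)] using k that sign[of n] by (auto simp: indep_def)
  moreover have "h \<notin> nbr n h i" if "\<nu> n h \<noteq> \<gamma> n"
    unfolding nbr_generic[OF assms(2-)] using that by (auto simp: indep_def)
  ultimately have "(if \<nu> n h = \<gamma> n then k else h) \<notin> nbr n h i" by simp
  moreover have "(if \<nu> n h = \<gamma> n then k else h) \<in> {..<2 ^ n} - {0, i}"
    using k assms by (auto simp: indep_def)
  moreover have "nbr n h i \<subseteq> {..<2 ^ n} - {0, i}" by (auto simp: nbr_def)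
  ultimately have "nbr n h i \<subset> {..<2 ^ n} - {0, i}" by blast
  then have "card (nbr n h i) < card ({..<2 ^ n} - {0, i})" by (intro psubset_card_mono) auto
  then show ?thesis using assms by (simp add: card_Diff_subset)
qed

text \<open>The neighbours over \<open>h\<close> and \<open>k XOR h\<close> are always present; a
  third one is an independent index where \<open>qsign\<close> is \<open>\<nu> n h\<close> instead
  of its negative.\<close>

lemma card_nbr_eq_2_iff:
  assumes "h < 2 ^ n" "h \<noteq> 0" "k < 2 ^ n" "k \<noteq> 0" "k \<noteq> h" "\<nu> n h = \<gamma> n"
  shows "card (nbr n h k) = 2 \<longleftrightarrow> full_row n h k"
proof -
  let ?A = "{l. l < 2 ^ n \<and> indep h k l \<and> F n h k l = \<gamma> n}"
  have "card (nbr n h k) = card (?A \<union> {h, k XOR h})"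
    using nbr_generic[OF assms(1-5)] assms(6) by simp
  also have "\<dots> = card ?A + card {h, k XOR h}"
    by (rule card_Un_disjoint) (auto simp: indep_def)
  also have "card {h, k XOR h} = 2" using assms by simp
  finally have "card (nbr n h k) = 2 \<longleftrightarrow> ?A = {}" by simp
  moreover have "F n h k l = \<gamma> n \<longleftrightarrow> F n h k l \<noteq> - \<nu> n h" for l
    using assms(6) sign[of n] \<sigma>_cases[of n k l] \<sigma>_cases[of n "l XOR h" "k XOR h"] \<sigma>_cases[of n "l XOR h" k]
      \<sigma>_cases[of n "k XOR h" l] by (auto simp: qsign_def)
  then have "?A = {} \<longleftrightarrow> full_row n h k"
    by (auto simp: full_row_def)
  ultimately show ?thesis by simp
qed

text \<open>This separates the centres from the vertices with \<open>h = 0\<close>, which have no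
  neighbours of degree 2.\<close>

lemma full_rows_nonempty:
  assumes "3 \<le> n" "h < 2 ^ n" "h \<noteq> 0"
  shows "card (full_rows n h) > 0"
proof (cases "h < 8")
  case True
  then show ?thesis using full_rows_special[of h 0 n] assms exp_ge_8[of n] by simp
next
  case False
  then obtain m h' where m: "3 \<le> m" "m < n" "h' < 2 ^ m" "h = h' + 2 ^ m"
    using nat_top_bit[of h n] assms by auto
  show ?thesis
  proof (cases "h' = 0")
    case True
    then show ?thesis using full_rows_special[of h m n] assms m exp_ge_8[of n] by simp
  next
    case False
    have "(2::nat) ^ 2 \<le> 2 ^ (n - m + 1)" using m by (intro power_increasing) auto
    then show ?thesis using card_full_rows[of m n h'] m False by simp
  qed
qed

lemma count2_set_centre:
  assumes "h < 2 ^ n" "h \<noteq> 0" "\<nu> n h = \<gamma> n"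
  shows "{k \<in> nbr n h h. card (nbr n h k) = 2} = full_rows n h"
  using nbr_centre[OF assms(1,2)] card_nbr_eq_2_iff[OF assms(1,2) _ _ _ assms(3)] assms
  by (auto simp: full_rows_def)

lemma card_nbr_max_iff:
  assumes "3 \<le> n" "h < 2 ^ n" "i < 2 ^ n" "i \<noteq> 0"
  shows "card (nbr n h i) = 2 ^ n - 2 \<longleftrightarrow> (if h = 0 then \<gamma> n = 1 else i = h \<and> \<nu> n h = \<gamma> n)"
proof -
  have *: "card ({..<2 ^ n} - {0, i}) = 2 ^ n - 2" using assms by (simp add: card_Diff_subset)
  have "(2::nat) ^ n - 2 \<noteq> 0" using exp_ge_8[OF assms(1)] by simp
  consider "h = 0" | "h \<noteq> 0" "i = h" | "h \<noteq> 0" "i \<noteq> h" by blast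
  then show ?thesis
  proof cases
    case 3
    then show ?thesis using card_nbr_generic_less[of n h i] assms by simp
  qed (use * assms exp_ge_8[OF assms(1)] in \<open>auto simp: nbr_zero nbr_centre\<close>)
qed

lemma count2_zero:
  assumes "3 \<le> n" "i < 2 ^ n" "i \<noteq> 0"
  shows "card {k \<in> nbr n 0 i. card (nbr n 0 k) = 2} = 0"
proof -
  have "card (nbr n 0 k) \<noteq> 2" if "k < 2 ^ n" "k \<noteq> 0" for k
  proof -
    have "card ({..<2 ^ n} - {0, k}) = 2 ^ n - 2" using that by (simp add: card_Diff_subset)
    moreover have "2 ^ n - 2 \<noteq> (2::nat)" using exp_ge_8[OF assms(1)] by linarith
    ultimately show ?thesis using that by (simp add: nbr_zero)
  qed
  then have "{k \<in> nbr n 0 i. card (nbr n 0 k) = 2} = {}" by (auto simp: nbr_def)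
  then show ?thesis by (simp only: card.empty)
qed

lemma degree_stat_Gamma_max_eq_0:
  assumes "3 \<le> n"
  shows "degree_stat (Gamma_verts \<gamma> n) (Gamma_adj \<gamma> n) (2 ^ n - 2) 0 > 0 \<longleftrightarrow> \<gamma> n = 1"
proof -
  let ?P = "{(h, i). h < 2 ^ n \<and> i < 2 ^ n \<and> i \<noteq> 0 \<and> card (nbr n h i) = 2 ^ n - 2 \<and>
      card {k \<in> nbr n h i. card (nbr n h k) = 2} = 0}"
  have P: "?P = (if \<gamma> n = 1 then {0} \<times> ({..<2 ^ n} - {0}) else {})"
  proof (intro set_eqI)
    fix x :: "nat \<times> nat"
    obtain h i where x: "x = (h, i)" by (cases x)
    show "x \<in> ?P \<longleftrightarrow> x \<in> (if \<gamma> n = 1 then {0} \<times> ({..<2 ^ n} - {0}) else {})"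
    proof (cases "h = 0")
      case True
      then show ?thesis using card_nbr_max_iff[OF assms, of h i] count2_zero[OF assms, of i] x by auto
    next
      case False
      have "x \<notin> ?P"
      proof
        assume P: "x \<in> ?P"
        then have "i = h \<and> \<nu> n h = \<gamma> n" using card_nbr_max_iff[OF assms, of h i] False x by simp
        then show False using P count2_set_centre[of h n] full_rows_nonempty[OF assms, of h] False x by simp
      qed
      then show ?thesis using False x by simp
    qed
  qed
  have "2 ^ n - 2 > (0::nat)" using exp_ge_8[OF assms] by simp
  then have "degree_stat (Gamma_verts \<gamma> n) (Gamma_adj \<gamma> n) (2 ^ n - 2) 0 = 2 * card ?P"
    by (rule degree_stat_Gamma)
  then show ?thesis
    unfolding P using exp_ge_8[OF assms] by (simp add: card_cartesian_product)
qed

lemma degree_stat_Gamma_max: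
  assumes "3 \<le> n" "r > 0"
  shows "degree_stat (Gamma_verts \<gamma> n) (Gamma_adj \<gamma> n) (2 ^ n - 2) r =
    2 * card {h. h < 2 ^ n \<and> h \<noteq> 0 \<and> \<nu> n h = \<gamma> n \<and> card (full_rows n h) = r}"
proof -
  let ?P = "{(h, i). h < 2 ^ n \<and> i < 2 ^ n \<and> i \<noteq> 0 \<and> card (nbr n h i) = 2 ^ n - 2 \<and>
      card {k \<in> nbr n h i. card (nbr n h k) = 2} = r}"
  let ?Q = "{h. h < 2 ^ n \<and> h \<noteq> 0 \<and> \<nu> n h = \<gamma> n \<and> card (full_rows n h) = r}"
  have "?P = (\<lambda>h. (h, h)) ` ?Q"
  proof (intro set_eqI)
    fix x :: "nat \<times> nat"
    obtain h i where x: "x = (h, i)" by (cases x)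
    have "x \<in> ?P \<longleftrightarrow> i = h \<and> h \<in> ?Q"
      using assms(2) card_nbr_max_iff[OF assms(1), of h i] count2_set_centre[of h n]
        count2_zero[OF assms(1), of i] x
      by (cases "h = 0") auto
    then show "x \<in> ?P \<longleftrightarrow> x \<in> (\<lambda>h. (h, h)) ` ?Q" using x by auto
  qed
  then have "card ?P = card ?Q" by (simp add: card_image inj_on_def)
  moreover have "2 ^ n - 2 > (0::nat)" using exp_ge_8[OF assms(1)] by simp
  ultimately show ?thesis using degree_stat_Gamma[of "2 ^ n - 2" n r] by simp
qed

section \<open>Counting indices of given norm\<close>

lemma \<nu>_mono: "h < 2 ^ m \<Longrightarrow> m \<le> n \<Longrightarrow> \<nu> n h = \<nu> m h"
proof (induction n)
  case (Suc n)
  show ?case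
  proof (cases "m = Suc n")
    case False
    then have "m \<le> n" using Suc by simp
    then have "(2::nat) ^ m \<le> 2 ^ n" by (intro power_increasing) auto
    then have "h < 2 ^ n" using Suc.prems by linarith
    then show ?thesis using Suc \<open>m \<le> n\<close> by simp
  qed simp
qed simp

lemma \<nu>_top: "h < 2 ^ m \<Longrightarrow> m < n \<Longrightarrow> \<nu> n (h + 2 ^ m) = - \<gamma> m * \<nu> m h"
proof -
  assume "h < 2 ^ m" "m < n"
  then have "\<nu> n (h + 2 ^ m) = \<nu> (Suc m) (h + 2 ^ m)" by (intro \<nu>_mono) auto
  then show "\<nu> n (h + 2 ^ m) = - \<gamma> m * \<nu> m h" by simp
qed

text \<open>Index 0 is left out: it yields no centre, and added to \<open>2 ^ m\<close> it yields a
  power of 2, which belongs to the special indices.\<close>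

definition norm_count :: "nat \<Rightarrow> real \<Rightarrow> nat" where
  "norm_count m c = card {h. h < 2 ^ m \<and> h \<noteq> 0 \<and> \<nu> m h = c}"

text \<open>A nontrivial character takes both values equally often, and \<open>\<nu> m\<close> is
  trivial exactly when all parameters below \<open>m\<close> are -1. In the induction the upper half
  contributes the indices of norm \<open>- \<gamma> m * c\<close>.\<close>

lemma card_norm_eq:
  assumes "c = 1 \<or> c = -1"
  shows "card {h. h < 2 ^ m \<and> \<nu> m h = c} =
    (if \<forall>k<m. \<gamma> k = -1 then if c = 1 then 2 ^ m else 0 else 2 ^ (m - 1))"
  using assms
proof (induction m arbitrary: c)
  case 0
  have "{h::nat. h < 1 \<and> 1 = c} = (if c = 1 then {0} else {})" by auto
  then show ?case by simp
next
  case (Suc m)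
  let ?N = "\<lambda>c. {h. h < 2 ^ m \<and> \<nu> m h = c}"
  have eq: "{h. h < 2 ^ Suc m \<and> \<nu> (Suc m) h = c} = ?N c \<union> (\<lambda>h. h + 2 ^ m) ` ?N (- \<gamma> m * c)"
  proof (intro set_eqI)
    fix H
    show "H \<in> {h. h < 2 ^ Suc m \<and> \<nu> (Suc m) h = c} \<longleftrightarrow> H \<in> ?N c \<union> (\<lambda>h. h + 2 ^ m) ` ?N (- \<gamma> m * c)"
    proof (cases "H < 2 ^ Suc m")
      case True
      then show ?thesis
      proof (elim less_exp_Suc_cases)
        fix h assume "h < 2 ^ m" "H = h + 2 ^ m"
        then show ?thesis using sign[of m] by auto
      qed auto
    qed auto
  qed
  have "card {h. h < 2 ^ Suc m \<and> \<nu> (Suc m) h = c} = card (?N c) + card (?N (- \<gamma> m * c))"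
    unfolding eq by (subst card_Un_disjoint) (auto simp: card_image)
  also have "\<dots> = (if \<forall>k<Suc m. \<gamma> k = -1 then if c = 1 then 2 ^ Suc m else 0 else 2 ^ (Suc m - 1))"
  proof -
    have "- \<gamma> m * c = 1 \<or> - \<gamma> m * c = -1" using sign[of m] Suc.prems by auto
    \<comment> \<open>For \<open>m = 0\<close> the condition on the parameters is vacuous, so the
      truncated exponent \<open>m - 1\<close> is not reached.\<close>
    moreover have "m \<noteq> 0 \<Longrightarrow> (2::nat) ^ (m - Suc 0) + 2 ^ (m - Suc 0) = 2 ^ m"
      by (cases m) auto
    ultimately show ?thesis
      using Suc.IH[of c] Suc.IH[of "- \<gamma> m * c"] Suc.prems sign[of m]
      by (cases "m = 0") (auto simp: less_Suc_eq)
  qed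
  finally show ?case .
qed

lemma norm_count_eq:
  assumes "c = 1 \<or> c = -1"
  shows "norm_count m c = (if \<forall>k<m. \<gamma> k = -1 then if c = 1 then 2 ^ m else 0 else 2 ^ (m - 1)) -
    (if c = 1 then 1 else 0)"
proof -
  have "norm_count m c = card ({h. h < 2 ^ m \<and> \<nu> m h = c} - {0})"
    unfolding norm_count_def by (rule arg_cong[where f = card]) auto
  also have "\<dots> = card {h. h < 2 ^ m \<and> \<nu> m h = c} - (if c = 1 then 1 else 0)"
    by (auto simp: card_Diff_singleton_if)
  finally show ?thesis using card_norm_eq[OF assms] by simp
qed

text \<open>This number of neighbours of degree 2 singles out the centres strictly between
  \<open>2 ^ m\<close> and \<open>2 ^ (m + 1)\<close>; \<open>\<nu>_top\<close> moves the norm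
  condition to level \<open>m\<close>.\<close>

lemma degree_stat_Gamma_top:
  assumes "3 \<le> m" "m < n"
  shows "degree_stat (Gamma_verts \<gamma> n) (Gamma_adj \<gamma> n) (2 ^ n - 2) (2 ^ (n - m + 1) - 2) =
    2 * norm_count m (- \<gamma> m * \<gamma> n)"
proof -
  let ?r = "2 ^ (n - m + 1) - 2 :: nat"
  have ge4: "(4::nat) \<le> 2 ^ (n - l + 1)" if "l < n" for l
    using power_increasing[of 2 "n - l + 1" "2::nat"] that by simp
  have r: "?r > 0" using ge4[OF assms(2)] by simp
  \<comment> \<open>The count would agree with that of the special indices only for
    \<open>m = 1\<close>.\<close>
  have special: "?r \<noteq> 2 ^ n - 2"
  proof
    assume "?r = 2 ^ n - 2"
    then have "(2::nat) ^ (n - m + 1) = 2 ^ n" using ge4[OF assms(2)] exp_ge_8[of n] assms by simp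
    then have "n - m + 1 = n" by (metis one_less_numeral_iff power_inject_exp semiring_norm(76))
    then show False using assms by simp
  qed
  let ?Q = "{h. h < 2 ^ n \<and> h \<noteq> 0 \<and> \<nu> n h = \<gamma> n \<and> card (full_rows n h) = ?r}"
  let ?R = "{h. h < 2 ^ m \<and> h \<noteq> 0 \<and> \<nu> m h = - \<gamma> m * \<gamma> n}"
  have "?Q = (\<lambda>h. h + 2 ^ m) ` ?R"
  proof (intro set_eqI iffI)
    fix H assume H: "H \<in> ?Q"
    then have "\<not> H < 8" using special full_rows_special[of H 0 n] by auto
    then obtain l h where l: "3 \<le> l" "l < n" "h < 2 ^ l" "H = h + 2 ^ l"
      using nat_top_bit[of H n] H by auto
    have h0: "h \<noteq> 0" using special full_rows_special[of H l n] H l by auto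
    then have "card (full_rows n H) + 2 = 2 ^ (n - l + 1)" using card_full_rows l by simp
    moreover have "card (full_rows n H) = ?r" using H by blast
    ultimately have "(2::nat) ^ (n - l + 1) = 2 ^ (n - m + 1)" using ge4[OF assms(2)] by linarith
    then have "n - l + 1 = n - m + 1"
      by (metis one_less_numeral_iff power_inject_exp semiring_norm(76))
    then have "l = m" using l assms by simp
    then show "H \<in> (\<lambda>h. h + 2 ^ m) ` ?R"
      using H l h0 \<nu>_top[of h m n] sign[of m] by (intro image_eqI[of _ _ h]) auto
  next
    fix H assume "H \<in> (\<lambda>h. h + 2 ^ m) ` ?R"
    then obtain h where h: "H = h + 2 ^ m" "h < 2 ^ m" "h \<noteq> 0" "\<nu> m h = - \<gamma> m * \<gamma> n" by auto
    have "(2::nat) ^ Suc m \<le> 2 ^ n" using assms by (intro power_increasing) auto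
    then have "H < 2 ^ n" using h by simp
    then show "H \<in> ?Q" using h card_full_rows[of m n h] \<nu>_top[of h m n] assms by auto
  qed
  then have "card ?Q = norm_count m (- \<gamma> m * \<gamma> n)"
    unfolding norm_count_def by (simp add: card_image inj_on_def)
  then show ?thesis using degree_stat_Gamma_max[of n ?r] r assms by simp
qed

text \<open>The special indices are those below 8 and the powers \<open>2 ^ m\<close> with
  \<open>m \<ge> 3\<close>, of norm \<open>- \<gamma> m\<close>. The second summand depends only on
  parameters from 3 on, which isolates the first three.\<close>

lemma degree_stat_Gamma_special:
  assumes "3 \<le> n"
  shows "degree_stat (Gamma_verts \<gamma> n) (Gamma_adj \<gamma> n) (2 ^ n - 2) (2 ^ n - 2) =
    2 * (norm_count 3 (\<gamma> n) + card {m \<in> {3..<n}. \<gamma> m = - \<gamma> n})"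
proof -
  let ?Q = "{h. h < 2 ^ n \<and> h \<noteq> 0 \<and> \<nu> n h = \<gamma> n \<and> card (full_rows n h) = 2 ^ n - 2}"
  let ?R = "{h. h < 2 ^ 3 \<and> h \<noteq> 0 \<and> \<nu> 3 h = \<gamma> n}"
  let ?S = "{m \<in> {3..<n}. \<gamma> m = - \<gamma> n}"
  have eq: "?Q = ?R \<union> (\<lambda>m. 2 ^ m) ` ?S"
  proof (intro set_eqI)
    fix H :: nat
    consider "H < 8" | "8 \<le> H" "H < 2 ^ n" | "8 \<le> H" "\<not> H < 2 ^ n" by linarith
    then show "H \<in> ?Q \<longleftrightarrow> H \<in> ?R \<union> (\<lambda>m. 2 ^ m) ` ?S"
    proof cases
      case 1
      then have "H < 2 ^ n" using exp_ge_8[OF assms] by simp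
      moreover have "H \<noteq> 2 ^ m" if "3 \<le> m" for m using exp_ge_8[OF that] 1 by simp
      ultimately show ?thesis
        using 1 full_rows_special[of H 0 n] \<nu>_mono[of H 3 n] assms by auto
    next
      case 2
      then obtain m h where m: "3 \<le> m" "m < n" "h < 2 ^ m" "H = h + 2 ^ m" by (rule nat_top_bit)
      have inj: "h + 2 ^ m = 2 ^ l \<longleftrightarrow> h = 0 \<and> l = m" for l
      proof
        assume l: "h + 2 ^ m = 2 ^ l"
        then have "(2::nat) ^ m \<le> 2 ^ l" by linarith
        moreover have "(2::nat) ^ l < 2 ^ Suc m" using l m(3) by simp
        ultimately have "l = m" by (metis le_antisym less_Suc_eq_le one_less_numeral_iff
          power_increasing_iff power_strict_increasing_iff semiring_norm(76))
        then show "h = 0 \<and> l = m" using l by simp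
      qed simp
      show ?thesis
      proof (cases "h = 0")
        case True
        then have H: "H = 2 ^ m" using m by simp
        have "H \<in> ?Q \<longleftrightarrow> \<gamma> m = - \<gamma> n"
          using full_rows_special[of H m n] \<nu>_top[of 0 m n] m 2 True by auto
        moreover have "H \<in> (\<lambda>m. 2 ^ m) ` ?S \<longleftrightarrow> \<gamma> m = - \<gamma> n"
          unfolding H using m(1,2) by (auto simp: image_iff)
        moreover have "H \<notin> ?R" using 2 by simp
        ultimately show ?thesis by blast
      next
        case False
        have "card (full_rows n H) \<noteq> 2 ^ n - 2"
        proof
          assume "card (full_rows n H) = 2 ^ n - 2"
          then have "(2::nat) ^ (n - m + 1) = 2 ^ n"
            using card_full_rows[of m n h] m False exp_ge_8[OF assms] by simp
          then have "n - m + 1 = n" by (metis one_less_numeral_iff power_inject_exp semiring_norm(76))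
          then show False using m by simp
        qed
        then show ?thesis using 2 m inj False by auto
      qed
    next
      case 3
      have "(2::nat) ^ m < 2 ^ n" if "m < n" for m using that by simp
      then show ?thesis using 3 by auto
    qed
  qed
  have "card (?R \<union> (\<lambda>m. 2 ^ m) ` ?S) = card ?R + card ((\<lambda>m. (2::nat) ^ m) ` ?S)"
    using exp_ge_8 by (intro card_Un_disjoint) (force simp: disjoint_iff not_less)+
  also have "card ((\<lambda>m. (2::nat) ^ m) ` ?S) = card ?S" by (simp add: card_image inj_on_def)
  finally have "card ?Q = norm_count 3 (\<gamma> n) + card ?S" using eq by (simp add: norm_count_def)
  moreover have "2 ^ n - 2 > (0::nat)" using exp_ge_8[OF assms] by simp
  ultimately show ?thesis using degree_stat_Gamma_max[OF assms] by simp
qed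

end

section \<open>Recovering the parameters from the counts\<close>

lemma norm_count_eqD:
  assumes "sign_params \<gamma>" "sign_params \<delta>" "3 \<le> m" "c = 1 \<or> c = -1" "d = 1 \<or> d = -1"
    and "sign_params.norm_count \<gamma> m c = sign_params.norm_count \<delta> m d"
  shows "c = d" "(\<forall>k<m. \<gamma> k = -1) \<longleftrightarrow> (\<forall>k<m. \<delta> k = -1)"
proof -
  obtain l where l: "m = Suc l" "2 \<le> l" using assms(3) by (cases m) auto
  have "(2::nat) ^ 2 \<le> 2 ^ l" using l by (intro power_increasing) auto
  then have *: "(4::nat) \<le> 2 ^ l" by simp
  \<comment> \<open>The four possible counts \<open>2 ^ m - 1\<close>, \<open>0\<close>,
    \<open>2 ^ (m - 1) - 1\<close> and \<open>2 ^ (m - 1)\<close> are pairwise distinct, as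
    \<open>2 ^ (m - 1)\<close> is at least 4.\<close>
  have "c = d \<and> ((\<forall>k<m. \<gamma> k = -1) \<longleftrightarrow> (\<forall>k<m. \<delta> k = -1))"
    using assms(6) unfolding sign_params.norm_count_eq[OF assms(1,4)] sign_params.norm_count_eq[OF assms(2,5)]
    using assms(4,5) * by (simp add: l(1) split: if_splits; auto)
  then show "c = d" "(\<forall>k<m. \<gamma> k = -1) \<longleftrightarrow> (\<forall>k<m. \<delta> k = -1)" by auto
qed

lemma Gamma_determines:
  assumes "sign_params \<gamma>" "sign_params \<delta>" "3 \<le> n"
    and iso: "graph_isomorphic (Gamma_verts \<gamma> n) (Gamma_adj \<gamma> n) (Gamma_verts \<delta> n) (Gamma_adj \<delta> n)"
  shows "\<forall>k\<in>{3..n}. \<gamma> k = \<delta> k" "(\<forall>k<3. \<gamma> k = -1) \<longleftrightarrow> (\<forall>k<3. \<delta> k = -1)"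
proof -
  interpret g: sign_params \<gamma> by fact
  interpret d: sign_params \<delta> by fact
  note stat = degree_stat_isomorphic[OF iso, of "2 ^ n - 2"]
  have n: "\<gamma> n = \<delta> n"
    using g.degree_stat_Gamma_max_eq_0[OF assms(3)] d.degree_stat_Gamma_max_eq_0[OF assms(3)]
      stat g.sign[of n] d.sign[of n] by auto
  have m: "\<gamma> m = \<delta> m" if "3 \<le> m" "m < n" for m
  proof -
    have "g.norm_count m (- \<gamma> m * \<gamma> n) = d.norm_count m (- \<delta> m * \<delta> n)"
      using g.degree_stat_Gamma_top[OF that] d.degree_stat_Gamma_top[OF that] stat by simp
    then have "- \<gamma> m * \<gamma> n = - \<delta> m * \<delta> n"
      using norm_count_eqD(1)[OF assms(1,2) that(1), of "- \<gamma> m * \<gamma> n" "- \<delta> m * \<delta> n"]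
        g.sign[of n] d.sign[of n] g.sign[of m] d.sign[of m] by auto
    then show ?thesis using n d.sign[of n] by auto
  qed
  \<comment> \<open>Parameters from 3 on already agree, so the powers of 2 contribute equally and
    cancel.\<close>
  have "{m \<in> {3..<n}. \<gamma> m = - \<gamma> n} = {m \<in> {3..<n}. \<delta> m = - \<delta> n}" using m n by auto
  then have "g.norm_count 3 (\<gamma> n) = d.norm_count 3 (\<delta> n)"
    using g.degree_stat_Gamma_special[OF assms(3)] d.degree_stat_Gamma_special[OF assms(3)] stat by simp
  then show "(\<forall>k<3. \<gamma> k = -1) \<longleftrightarrow> (\<forall>k<3. \<delta> k = -1)"
    using norm_count_eqD(2)[OF assms(1,2)] g.sign d.sign by blast
  show "\<forall>k\<in>{3..n}. \<gamma> k = \<delta> k" 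
  proof
    fix k assume "k \<in> {3..n}"
    then show "\<gamma> k = \<delta> k" using m[of k] n by (cases "k = n") auto
  qed
qed

subsection \<open>Isomorphisms of octonion algebras\<close>

lemma cd_mult_cong: "(\<And>k. k < n \<Longrightarrow> \<gamma> k = \<delta> k) \<Longrightarrow> cd_mult \<gamma> n = cd_mult \<delta> n"
proof (induction n)
  case (Suc n)
  then have "cd_mult \<gamma> n = cd_mult \<delta> n" "\<gamma> n = \<delta> n" by auto
  then show ?case by (intro ext) simp
qed (auto simp: fun_eq_iff)

lemma cd_algebra_isomorphic_refl:
  assumes "\<And>k. k < n \<Longrightarrow> \<gamma> k = \<delta> k"
  shows "cd_algebra_isomorphic n \<gamma> \<delta>"
proof -
  have "cd_mult \<gamma> n = cd_mult \<delta> n" using assms by (rule cd_mult_cong)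
  then show ?thesis unfolding cd_algebra_isomorphic_def by (intro exI[of _ id]) auto
qed

lemma cd_algebra_isomorphic_trans:
  assumes "cd_algebra_isomorphic n \<alpha> \<beta>" "cd_algebra_isomorphic n \<beta> \<gamma>"
  shows "cd_algebra_isomorphic n \<alpha> \<gamma>"
proof -
  let ?C = "cd_carrier n"
  obtain f where f: "bij_betw f ?C ?C" "\<forall>x\<in>?C. \<forall>y\<in>?C. f (x + y) = f x + f y"
    "\<forall>t. \<forall>x\<in>?C. f (cd_scale t x) = cd_scale t (f x)"
    "\<forall>x\<in>?C. \<forall>y\<in>?C. f (cd_mult \<alpha> n x y) = cd_mult \<beta> n (f x) (f y)"
    using assms(1) by (auto simp: cd_algebra_isomorphic_def)
  obtain g where g: "bij_betw g ?C ?C" "\<forall>x\<in>?C. \<forall>y\<in>?C. g (x + y) = g x + g y"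
    "\<forall>t. \<forall>x\<in>?C. g (cd_scale t x) = cd_scale t (g x)"
    "\<forall>x\<in>?C. \<forall>y\<in>?C. g (cd_mult \<beta> n x y) = cd_mult \<gamma> n (g x) (g y)"
    using assms(2) by (auto simp: cd_algebra_isomorphic_def)
  have "f x \<in> ?C" if "x \<in> ?C" for x using f(1) that by (rule bij_betw_apply)
  then show ?thesis
    unfolding cd_algebra_isomorphic_def
    using bij_betw_trans[OF f(1) g(1)] f(2-) g(2-) by (intro exI[of _ "g \<circ> f"]) auto
qed

lemma cd_mult_eq_0: "2 ^ n \<le> i \<Longrightarrow> cd_mult \<gamma> n x y i = 0"
  by (induction n arbitrary: i x y) (auto simp: Let_def cd_pair_def)

lemma cd_mult_carrier [simp]: "cd_mult \<gamma> n x y \<in> cd_carrier n"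
  by (simp add: cd_carrier_def cd_mult_eq_0)

lemma cd_algebra_isomorphic_sym:
  assumes "cd_algebra_isomorphic n \<gamma> \<delta>"
  shows "cd_algebra_isomorphic n \<delta> \<gamma>"
proof -
  let ?C = "cd_carrier n"
  obtain f where f: "bij_betw f ?C ?C" "\<forall>x\<in>?C. \<forall>y\<in>?C. f (x + y) = f x + f y"
    "\<forall>t. \<forall>x\<in>?C. f (cd_scale t x) = cd_scale t (f x)"
    "\<forall>x\<in>?C. \<forall>y\<in>?C. f (cd_mult \<gamma> n x y) = cd_mult \<delta> n (f x) (f y)"
    using assms by (auto simp: cd_algebra_isomorphic_def)
  define g where "g = inv_into ?C f"
  have g: "bij_betw g ?C ?C" unfolding g_def using f(1) by (rule bij_betw_inv_into)
  have gC: "g x \<in> ?C" if "x \<in> ?C" for x using g that by (rule bij_betw_apply)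
  have fg: "f (g x) = x" if "x \<in> ?C" for x
    using f(1) that by (simp add: g_def bij_betw_inv_into_right)
  have gI: "g y = x" if "f x = y" "x \<in> ?C" for x y
    using f(1) that by (auto simp: g_def bij_betw_inv_into_left)
  show ?thesis
    unfolding cd_algebra_isomorphic_def
  proof (intro exI[of _ g] conjI ballI allI g)
    fix x y assume "x \<in> ?C" "y \<in> ?C"
    then show "g (x + y) = g x + g y" "g (cd_mult \<delta> n x y) = cd_mult \<gamma> n (g x) (g y)"
      using f(2,4) gC fg cd_mult_carrier by (auto intro!: gI)
  next
    fix t x assume "x \<in> ?C"
    then show "g (cd_scale t x) = cd_scale t (g x)" using f(3) gC fg by (auto intro!: gI)
  qed
qed

section \<open>Coordinates of products, and relabelled bases\<close>

lemma sum_xor: "k < 2 ^ n \<Longrightarrow> (\<Sum>j<2 ^ n. g (j XOR k)) = (\<Sum>j<(2::nat) ^ n. g j)"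
  by (rule sum.reindex_bij_witness[of _ "\<lambda>j. j XOR k" "\<lambda>j. j XOR k"]) auto

lemma sum_lessThan_exp_Suc:
  "(\<Sum>j<2 ^ Suc n. g j) = (\<Sum>j<2 ^ n. g j) + (\<Sum>j<(2::nat) ^ n. g (j + 2 ^ n))"
proof -
  have "(\<Sum>j<m + k. g j) = (\<Sum>j<m. g j) + (\<Sum>j<k. g (j + m))" for m k
    by (induction k) (simp_all add: add_ac)
  from this[of "2 ^ n" "2 ^ n"] show ?thesis by (simp add: mult_2)
qed

lemma cd_conj_apply: "i < 2 ^ n \<Longrightarrow> cd_conj n x i = csign i * x i"
proof (induction n arbitrary: i x)
  case (Suc n)
  from Suc.prems show ?case
    by (elim less_exp_Suc_cases)
      (auto simp: cd_pair_def cd_fst_def cd_snd_def Suc.IH csign_def)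
qed (simp add: csign_def)

text \<open>The product is a convolution over the XOR group twisted by \<open>bsign\<close>.
  Doubling reverses the arguments in two products, and \<open>sum_xor\<close> makes those sums run
  over the coordinates of \<open>x\<close> again.\<close>

lemma cd_mult_apply:
  assumes "k < 2 ^ n"
  shows "cd_mult \<gamma> n x y k = (\<Sum>j<2 ^ n. bsign \<gamma> n j (j XOR k) * x j * y (j XOR k))"
  using assms
proof (induction n arbitrary: k x y)
  case (Suc n)
  let ?b = "bsign \<gamma> n" and ?N = "2 ^ n :: nat"
  let ?a = "cd_fst n x" and ?b' = "cd_snd n x" and ?c = "cd_fst n y" and ?d = "cd_snd n y"
  from Suc.prems show ?case
  proof (elim less_exp_Suc_cases)
    assume k: "k < 2 ^ n"
    have "cd_mult \<gamma> n (cd_conj n ?d) ?b' k = (\<Sum>j<?N. ?b j (j XOR k) * cd_conj n ?d j * ?b' (j XOR k))"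
      using k by (rule Suc.IH)
    also have "\<dots> = (\<Sum>j<?N. ?b (j XOR k) j * cd_conj n ?d (j XOR k) * ?b' j)"
      using sum_xor[OF k, of "\<lambda>j. ?b j (j XOR k) * cd_conj n ?d j * ?b' (j XOR k)"] by simp
    finally show ?thesis
      using k by (auto simp: Let_def cd_pair_def cd_scale_def Suc.IH sum_lessThan_exp_Suc cd_conj_apply
        cd_fst_def cd_snd_def sum_distrib_left mult_ac simp del: power_Suc intro!: sum.cong)
  next
    fix k' assume k: "k' < 2 ^ n" "k = k' + 2 ^ n"
    have "cd_mult \<gamma> n ?d ?a k' = (\<Sum>j<?N. ?b j (j XOR k') * ?d j * ?a (j XOR k'))"
      using k(1) by (rule Suc.IH)
    also have "\<dots> = (\<Sum>j<?N. ?b (j XOR k') j * ?d (j XOR k') * ?a j)"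
      using sum_xor[OF k(1), of "\<lambda>j. ?b j (j XOR k') * ?d j * ?a (j XOR k')"] by simp
    finally show ?thesis
      using k by (auto simp: Let_def cd_pair_def Suc.IH sum_lessThan_exp_Suc cd_conj_apply csign_def
        cd_fst_def cd_snd_def mult_ac simp del: power_Suc intro!: sum.cong)
  qed
qed simp

text \<open>Lists allow a concrete relabelling to be checked entry by entry.\<close>

definition relabel :: "nat list \<Rightarrow> real list \<Rightarrow> vec \<Rightarrow> vec" where
  "relabel q s x = (\<lambda>i. if i < length q then s ! i * x (q ! i) else 0)"

text \<open>Both algebras are twisted group algebras of the XOR group: a group automorphism with a
  rescaling of the basis is multiplicative once it carries one twist to the other.\<close>

lemma relabel_isomorphic:
  assumes q: "length q = 2 ^ n" "distinct q" "set q \<subseteq> {..<2 ^ n}" and s: "\<forall>i<2 ^ n. s ! i \<noteq> 0"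
    and mult: "\<forall>i<2 ^ n. \<forall>j<2 ^ n. q ! (i XOR j) = q ! i XOR q ! j \<and>
      s ! i * s ! j * bsign \<delta> n i j = s ! (i XOR j) * bsign \<gamma> n (q ! i) (q ! j)"
  shows "cd_algebra_isomorphic n \<gamma> \<delta>"
proof -
  let ?C = "cd_carrier n"
  have "set q = {..<2 ^ n}"
    using q by (intro card_subset_eq) (auto simp: distinct_card)
  then have bij: "bij_betw ((!) q) {..<2 ^ n} {..<2 ^ n}" using bij_betw_nth[OF q(2)] q by simp
  have q_less: "q ! i < 2 ^ n" if "i < 2 ^ n" for i using bij that by (auto dest: bij_betw_apply)
  have "inj_on (relabel q s) ?C"
  proof (rule inj_onI, rule ext)
    fix x y j assume xy: "x \<in> ?C" "y \<in> ?C" "relabel q s x = relabel q s y"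
    show "x j = y j"
    proof (cases "j < 2 ^ n")
      case True
      then obtain i where "i < 2 ^ n" "j = q ! i" using bij unfolding bij_betw_def by blast
      then show ?thesis using fun_cong[OF xy(3), of i] s q by (simp add: relabel_def)
    qed (use xy in \<open>simp add: cd_carrier_def\<close>)
  qed
  moreover have "relabel q s ` ?C = ?C"
  proof (intro equalityI subsetI)
    fix y assume y: "y \<in> ?C"
    define r where "r = inv_into {..<2 ^ n} ((!) q)"
    have r: "r (q ! i) = i" if "i < 2 ^ n" for i
      using bij that by (simp add: r_def bij_betw_inv_into_left)
    define x where "x = (\<lambda>j. if j < 2 ^ n then y (r j) / s ! r j else 0)"
    have "relabel q s x = y"
      using y s q r q_less by (auto simp: relabel_def x_def cd_carrier_def fun_eq_iff)
    moreover have "x \<in> ?C" by (simp add: x_def cd_carrier_def)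
    ultimately show "y \<in> relabel q s ` ?C" by blast
  qed (use q in \<open>auto simp: relabel_def cd_carrier_def\<close>)
  moreover have "relabel q s (cd_mult \<gamma> n x y) = cd_mult \<delta> n (relabel q s x) (relabel q s y)" for x y
  proof
    fix i
    show "relabel q s (cd_mult \<gamma> n x y) i = cd_mult \<delta> n (relabel q s x) (relabel q s y) i"
    proof (cases "i < 2 ^ n")
      case True
      have "cd_mult \<gamma> n x y (q ! i) =
          (\<Sum>j<2 ^ n. bsign \<gamma> n j (j XOR q ! i) * x j * y (j XOR q ! i))"
        using q_less[OF True] by (rule cd_mult_apply)
      also have "\<dots> = (\<Sum>m<2 ^ n. bsign \<gamma> n (q ! m) (q ! m XOR q ! i) * x (q ! m) * y (q ! m XOR q ! i))"
        by (rule sum.reindex_bij_betw[OF bij, symmetric])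
      finally have "s ! i * cd_mult \<gamma> n x y (q ! i) = (\<Sum>m<2 ^ n.
          (s ! i * bsign \<gamma> n (q ! m) (q ! m XOR q ! i)) * x (q ! m) * y (q ! m XOR q ! i))"
        by (simp add: sum_distrib_left mult.assoc)
      also have "\<dots> = (\<Sum>m<2 ^ n. bsign \<delta> n m (m XOR i) * (s ! m * x (q ! m)) *
          (s ! (m XOR i) * y (q ! (m XOR i))))"
      proof (rule sum.cong[OF refl])
        fix m :: nat assume "m \<in> {..<2 ^ n}"
        then have m: "m < 2 ^ n" "m XOR i < 2 ^ n" using True by auto
        have "s ! m * s ! (m XOR i) * bsign \<delta> n m (m XOR i) =
            s ! i * bsign \<gamma> n (q ! m) (q ! (m XOR i))"
          using mult[rule_format, OF m] by simp
        moreover have "q ! (m XOR i) = q ! m XOR q ! i" using mult m True by blast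
        ultimately show "s ! i * bsign \<gamma> n (q ! m) (q ! m XOR q ! i) * x (q ! m) * y (q ! m XOR q ! i) =
            bsign \<delta> n m (m XOR i) * (s ! m * x (q ! m)) * (s ! (m XOR i) * y (q ! (m XOR i)))"
          by (metis (no_types, lifting) mult.assoc mult.commute)
      qed
      finally show ?thesis
        using True q by (simp add: relabel_def cd_mult_apply)
    qed (use q in \<open>simp add: relabel_def cd_mult_eq_0\<close>)
  qed
  ultimately show ?thesis
    unfolding cd_algebra_isomorphic_def
    by (intro exI[of _ "relabel q s"])
      (auto simp: bij_betw_def relabel_def cd_scale_def fun_eq_iff algebra_simps)
qed

lemma all_less_8: "(\<forall>i<8. P i) \<longleftrightarrow> P 0 \<and> P 1 \<and> P 2 \<and> P 3 \<and> P 4 \<and> P 5 \<and> P 6 \<and> P (7::nat)"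
proof (intro iffI allI impI)
  fix i :: nat assume "P 0 \<and> P 1 \<and> P 2 \<and> P 3 \<and> P 4 \<and> P 5 \<and> P 6 \<and> P 7" "i < 8"
  moreover from \<open>i < 8\<close> have "i = 0 \<or> i = 1 \<or> i = 2 \<or> i = 3 \<or> i = 4 \<or> i = 5 \<or> i = 6 \<or> i = 7" by arith
  ultimately show "P i" by auto
qed auto

text \<open>The level is spelled with \<open>Suc\<close> so that \<open>bsign\<close> unfolds in the
  64 checks.\<close>

lemma relabel_3_isomorphic:
  assumes "length q = 8" "distinct q" "set q \<subseteq> {..<8}" "\<forall>i<8. s ! i \<noteq> 0"
    and "\<forall>i<8. \<forall>j<8. q ! (i XOR j) = q ! i XOR q ! j \<and> s ! i * s ! j * bsign \<delta> (Suc (Suc (Suc 0))) i j =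
      s ! (i XOR j) * bsign \<gamma> (Suc (Suc (Suc 0))) (q ! i) (q ! j)"
  shows "cd_algebra_isomorphic 3 \<gamma> \<delta>"
  using assms by (intro relabel_isomorphic[of q 3 s]) (auto simp flip: numeral_3_eq_3)

text \<open>The split octonions as a double of the quaternions: the normal form for all triples of
  parameters that are not constantly -1.\<close>

definition split_params :: "nat \<Rightarrow> real" where
  "split_params k = (if k = 2 then 1 else -1)"

text \<open>\<open>relabel q s\<close> sends the basis element of index \<open>q ! i\<close> to \<open>s ! i\<close> times the one of index \<open>i\<close>.
  The lists come from three independent basis elements of \<open>split_params\<close> whose squares are
  \<open>\<gamma> 0, \<gamma> 1, \<gamma> 2\<close>; the other signs are then forced by multiplicativity.\<close>

lemma split_octonions_isomorphic:
  assumes "sign_params \<gamma>" "\<not> (\<forall>k<3. \<gamma> k = -1)"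
  shows "cd_algebra_isomorphic 3 \<gamma> split_params"
proof -
  \<comment> \<open>Unfolding \<open>bsign\<close> produces \<open>\<gamma> (Suc (Suc 0))\<close>,
    while the cases speak of \<open>\<gamma> 2\<close>.\<close>
  have "\<gamma> (Suc (Suc 0)) = \<gamma> 2" by (simp only: numeral_2_eq_2)
  note check = all_less_8 split_params_def csign_def this
  have sgn: "\<gamma> k = 1 \<or> \<gamma> k = -1" for k using assms(1) by (rule sign_params.sign)
  have "(\<forall>k<3. \<gamma> k = -1) \<longleftrightarrow> \<gamma> 0 = -1 \<and> \<gamma> 1 = -1 \<and> \<gamma> 2 = -1"
    by (auto simp: numeral_3_eq_3 less_Suc_eq numeral_2_eq_2)
  then consider (c0) "\<gamma> 0 = 1" "\<gamma> 1 = 1" "\<gamma> 2 = 1"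
    | (c1) "\<gamma> 0 = 1" "\<gamma> 1 = 1" "\<gamma> 2 = -1"
    | (c2) "\<gamma> 0 = 1" "\<gamma> 1 = -1" "\<gamma> 2 = 1"
    | (c3) "\<gamma> 0 = 1" "\<gamma> 1 = -1" "\<gamma> 2 = -1"
    | (c4) "\<gamma> 0 = -1" "\<gamma> 1 = 1" "\<gamma> 2 = 1"
    | (c5) "\<gamma> 0 = -1" "\<gamma> 1 = 1" "\<gamma> 2 = -1"
    | (c6) "\<gamma> 0 = -1" "\<gamma> 1 = -1" "\<gamma> 2 = 1"
    using assms(2) sgn[of 0] sgn[of 1] sgn[of 2] by metis
  then show ?thesis
  proof cases
    case c0
    then show ?thesis
      by (intro relabel_3_isomorphic[of "[0, 3, 5, 6, 1, 2, 4, 7]" "[1, -1, -1, 1, 1, 1, 1, 1]"]) (simp_all add: check)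
  next
    case c1
    then show ?thesis
      by (intro relabel_3_isomorphic[of "[0, 3, 4, 7, 1, 2, 5, 6]" "[1, -1, 1, -1, 1, 1, -1, -1]"]) (simp_all add: check)
  next
    case c2
    then show ?thesis
      by (intro relabel_3_isomorphic[of "[0, 2, 5, 7, 1, 3, 4, 6]" "[1, 1, -1, -1, 1, -1, 1, -1]"]) (simp_all add: check)
  next
    case c3
    then show ?thesis
      by (intro relabel_3_isomorphic[of "[0, 2, 4, 6, 1, 3, 5, 7]" "[1, 1, 1, 1, 1, -1, -1, 1]"]) (simp_all add: check)
  next
    case c4
    then show ?thesis
      by (intro relabel_3_isomorphic[of "[0, 1, 6, 7, 2, 3, 4, 5]" "[1, 1, -1, 1, 1, 1, 1, -1]"]) (simp_all add: check)
  next
    case c5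
    then show ?thesis
      by (intro relabel_3_isomorphic[of "[0, 1, 4, 5, 2, 3, 6, 7]" "[1, 1, 1, 1, 1, 1, -1, -1]"]) (simp_all add: check)
  next
    case c6
    then show ?thesis
      by (intro cd_algebra_isomorphic_refl) (auto simp: split_params_def numeral_eq_Suc less_Suc_eq)
  qed
qed

text \<open>The graph sees the parameters only through the product at level
  \<open>n + 1\<close>.\<close>

lemma Gamma_verts_cong:
  assumes "\<forall>k\<le>n. \<gamma> k = \<delta> k"
  shows "Gamma_verts \<gamma> n = Gamma_verts \<delta> n" "Gamma_adj \<gamma> n = Gamma_adj \<delta> n"
proof -
  have "cd_mult \<gamma> (Suc n) = cd_mult \<delta> (Suc n)" using assms by (intro cd_mult_cong) auto
  then have "cd_zero_divisor \<gamma> (Suc n) = cd_zero_divisor \<delta> (Suc n)"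
    and orth: "cd_orthogonal \<gamma> (Suc n) = cd_orthogonal \<delta> (Suc n)"
    by (intro ext, simp only: cd_zero_divisor_def cd_orthogonal_def)+
  then have "Gamma_gens \<gamma> n = Gamma_gens \<delta> n" by (simp only: Gamma_gens_def)
  then show "Gamma_verts \<gamma> n = Gamma_verts \<delta> n" "Gamma_adj \<gamma> n = Gamma_adj \<delta> n"
    using orth by (simp only: Gamma_verts_def, intro ext, simp only: Gamma_adj_def)
qed

theorem theorem5p15:
  fixes n :: nat and \<gamma> \<delta> :: "nat \<Rightarrow> real"
  assumes "n \<ge> 3"
    and "\<forall>k\<le>n. \<gamma> k \<in> {1, -1}"
    and "\<forall>k\<le>n. \<delta> k \<in> {1, -1}"
    and "graph_isomorphic (Gamma_verts \<gamma> n) (Gamma_adj \<gamma> n) (Gamma_verts \<delta> n) (Gamma_adj \<delta> n)"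
  shows "(\<forall>k\<in>{3..n}. \<gamma> k = \<delta> k) \<and> cd_algebra_isomorphic 3 \<gamma> \<delta>"
proof -
  \<comment> \<open>\<open>sign_params\<close> asks for a sign at every index; beyond
    \<open>n\<close> the value 1 is filled in, which leaves the graphs unchanged.\<close>
  define \<gamma>' \<delta>' where "\<gamma>' = (\<lambda>k. if k \<le> n then \<gamma> k else 1)" and "\<delta>' = (\<lambda>k. if k \<le> n then \<delta> k else 1)"
  have sgn: "sign_params \<gamma>'" "sign_params \<delta>'"
    using assms(2,3) by (auto simp: sign_params_def \<gamma>'_def \<delta>'_def)
  have eq: "\<forall>k\<le>n. \<gamma> k = \<gamma>' k" "\<forall>k\<le>n. \<delta> k = \<delta>' k" by (simp_all add: \<gamma>'_def \<delta>'_def)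
  have "graph_isomorphic (Gamma_verts \<gamma>' n) (Gamma_adj \<gamma>' n) (Gamma_verts \<delta>' n) (Gamma_adj \<delta>' n)"
    using assms(4) Gamma_verts_cong[OF eq(1)] Gamma_verts_cong[OF eq(2)] by simp
  note det = Gamma_determines[OF sgn assms(1) this]
  \<comment> \<open>Either both initial triples are constantly -1 and so equal, or both give the
    split octonions.\<close>
  have "cd_algebra_isomorphic 3 \<gamma>' \<delta>'"
  proof (cases "\<forall>k<3. \<gamma>' k = -1")
    case True
    then show ?thesis using det(2) by (intro cd_algebra_isomorphic_refl) auto
  next
    case False
    then have "cd_algebra_isomorphic 3 \<gamma>' split_params" "cd_algebra_isomorphic 3 \<delta>' split_params"
      using det(2) sgn split_octonions_isomorphic by blast+
    then show ?thesis using cd_algebra_isomorphic_sym cd_algebra_isomorphic_trans by blast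
  qed
  moreover have "cd_algebra_isomorphic 3 \<gamma> \<gamma>'" "cd_algebra_isomorphic 3 \<delta>' \<delta>"
    using eq assms(1) by (auto intro!: cd_algebra_isomorphic_refl)
  ultimately have "cd_algebra_isomorphic 3 \<gamma> \<delta>" using cd_algebra_isomorphic_trans by blast
  then show ?thesis using det(1) eq by auto
qed

end
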